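(* Let $B$ be a separable Banach space and let $\{X_n:n\ge 1\}$ be i.i.d. $B$-valued random variables with $\mathbb{E}[e^{t\|X_1\|}]<\infty$ for all $t>0$. Let $\{N_n:n\ge 1\}$ be nonnegative integer-valued random variables, independent of $\{X_n:n\ge 1\}$, such that the function $$\Lambda_N(\eta):=\lim_{n\to\infty}\frac1n\log\mathbb{E}[e^{\eta N_n}]\qquad(\eta\in\mathbb{R})$$ is well-defined, finite valued and differentiable on $\mathbb{R}$. Let $S_k:=X_1+\cdots+X_k$. Then the sequence $\left\{\left(\frac{S_{N_n}}{n},\frac{N_n}{n}\right):n\ge 1\right\}$ of $B\times\mathbb{R}$-valued random variables satisfies the large deviation principle with speed $n$ and good rate function $$I_{S,N}(x,y):=\sup_{\theta\in B^*,\,\eta\in\mathbb{R}}\{\langle\theta,x\rangle+\eta y-\Lambda_N(\eta+\Lambda_X(\theta))\}\qquad\text{for all }(x,y)\in B\times\mathbb{R}.$$ Moreover, $$I_{S,N}(x,y)=\begin{cases} y\,\Lambda_X^*\left(\frac{x}{y}\right)+\Lambda_N^*(y) & \text{if } y>0,\\ -\Lambda_N(-\infty) & \text{if } (x,y)=(\widehat 0,0),\\ \infty & \text{otherwise.}\end{cases}$$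
   Context: $B^*$ is the dual of $B$, $\langle\cdot,\cdot\rangle$ is the duality pairing between $B^*$ and $B$, $\widehat 0$ is the null vector of $B$. $S_0:=\widehat 0$ (empty sum). $\Lambda_X(\theta):=\log\mathbb{E}[e^{\langle\theta,X_1\rangle}]$ for $\theta\in B^*$; $\Lambda_X^*(x):=\sup_{\theta\in B^*}\{\langle\theta,x\rangle-\Lambda_X(\theta)\}$ for $x\in B$; $\Lambda_N^*(y):=\sup_{\eta\in\mathbb{R}}\{\eta y-\Lambda_N(\eta)\}$ for $y\in\mathbb{R}$; $\Lambda_N(-\infty):=\lim_{\eta\to-\infty}\Lambda_N(\eta)\in[-\infty,0]$ (the limit exists since $\Lambda_N$ is non-decreasing). A sequence $\{Z_n\}$ of random variables on $(\Omega,\mathcal{F},P)$ with values in a topological space $\mathcal{X}$ satisfies the large deviation principle with speed $v_n\to\infty$ and rate function $I:\mathcal{X}\to[0,\infty]$ if $I$ is lower semicontinuous, $\liminf_{n}\frac1{v_n}\log P(Z_n\in O)\ge-\inf_{x\in O}I(x)$ for all open sets $O$, and $\limsup_n\frac1{v_n}\log P(Z_n\in C)\le-\inf_{x\in C}I(x)$ for all closed sets $C$. The rate function is good if all its level sets $\{x:I(x)\le c\}$, $c\ge 0$, are compact. *)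

theory Defs
  imports "HOL-Probability.Probability"
begin

definition ext_ln :: "ennreal \<Rightarrow> ereal" where
  "ext_ln p = (if p = 0 then -\<infinity> else if p = \<infinity> then \<infinity> else ereal (ln (enn2real p)))"

definition lower_semicont :: "('c::topological_space \<Rightarrow> ereal) \<Rightarrow> bool" where
  "lower_semicont I \<longleftrightarrow> (\<forall>c::real. closed {x. I x \<le> ereal c})"

text \<open>Sequences are indexed by \<open>n \<ge> 1\<close>; their value at index 0 is irrelevant. With values in
  \<^typ>\<open>ereal\<close>, the infimum over the empty set is \<open>\<infinity>\<close>.\<close>

definition satisfies_LDP ::
  "'a measure \<Rightarrow> (nat \<Rightarrow> 'a \<Rightarrow> 'c::topological_space) \<Rightarrow> (nat \<Rightarrow> real) \<Rightarrow> ('c \<Rightarrow> ereal) \<Rightarrow> bool" where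
  "satisfies_LDP M Z v I \<longleftrightarrow>
     (\<forall>n\<ge>1. Z n \<in> borel_measurable M) \<and>
     filterlim v at_top sequentially \<and>
     (\<forall>x. 0 \<le> I x) \<and>
     lower_semicont I \<and>
     (\<forall>U. open U \<longrightarrow>
        liminf (\<lambda>n. ereal (1 / v n) * ext_ln (emeasure M {\<omega> \<in> space M. Z n \<omega> \<in> U}))
          \<ge> - (INF x\<in>U. I x)) \<and>
     (\<forall>C. closed C \<longrightarrow>
        limsup (\<lambda>n. ereal (1 / v n) * ext_ln (emeasure M {\<omega> \<in> space M. Z n \<omega> \<in> C}))
          \<le> - (INF x\<in>C. I x))"

definition good_rate :: "('c::topological_space \<Rightarrow> ereal) \<Rightarrow> bool" where
  "good_rate I \<longleftrightarrow> (\<forall>c::real. c \<ge> 0 \<longrightarrow> compact {x. I x \<le> ereal c})"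

text \<open>The logarithm is real-valued, so this is the log-moment generating function only when
  \<open>exp \<langle>\<theta>, Y\<rangle>\<close> is integrable for all \<open>\<theta>\<close>; this holds if \<open>exp (t * norm Y)\<close> is integrable for all
  \<open>t > 0\<close>.\<close>

definition log_mgf ::
  "'a measure \<Rightarrow> ('a \<Rightarrow> 'b::real_normed_vector) \<Rightarrow> ('b \<Rightarrow>\<^sub>L real) \<Rightarrow> real" where
  "log_mgf M Y \<theta> = ln (\<integral>\<omega>. exp (blinfun_apply \<theta> (Y \<omega>)) \<partial>M)"

definition dual_conjugate ::
  "(('b::real_normed_vector \<Rightarrow>\<^sub>L real) \<Rightarrow> real) \<Rightarrow> 'b \<Rightarrow> ereal" where
  "dual_conjugate L x = (SUP \<theta>. ereal (blinfun_apply \<theta> x - L \<theta>))"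

definition real_conjugate :: "(real \<Rightarrow> real) \<Rightarrow> real \<Rightarrow> ereal" where
  "real_conjugate L y = (SUP \<eta>. ereal (\<eta> * y - L \<eta>))"

definition rate_SN ::
  "(('b::real_normed_vector \<Rightarrow>\<^sub>L real) \<Rightarrow> real) \<Rightarrow> (real \<Rightarrow> real) \<Rightarrow> 'b \<times> real \<Rightarrow> ereal" where
  "rate_SN \<Lambda>\<^sub>X \<Lambda>\<^sub>N = (\<lambda>(x, y).
     SUP (\<theta>, \<eta>)\<in>UNIV. ereal (blinfun_apply \<theta> x + \<eta> * y - \<Lambda>\<^sub>N (\<eta> + \<Lambda>\<^sub>X \<theta>)))"

definition limit_at_minus_infinity :: "(real \<Rightarrow> real) \<Rightarrow> ereal" where
  "limit_at_minus_infinity L = Lim at_bot (\<lambda>\<eta>. ereal (L \<eta>))"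

end

theory Submission
  imports Defs
begin

text \<open>The log-moment generating functions of the pairs converge, after scaling, to
  \<open>L(\<theta>, \<eta>) = \<Lambda>\<^sub>N(\<eta> + \<Lambda>\<^sub>X(\<theta>))\<close>, because conditionally on \<open>N n\<close> the sum is a sum of i.i.d. vectors.
  This limit is finite, continuous and Gateaux differentiable, and its derivatives are represented by
  vectors of the space (Bochner integrals), so everything follows from a Gaertner-Ellis theorem in
  Banach spaces once the pairs are known to be exponentially tight.

  In the Gaertner-Ellis theorem the upper bound is the usual covering by half-spaces. For the lower bound
  at \<open>z\<close>, Ekeland's variational principle applied to \<open>L - \<langle>\<cdot>, z\<rangle>\<close> yields a functional at which the
  gradient of \<open>L\<close> is close to \<open>z\<close> and the entropy is not much larger than the rate at \<open>z\<close>; tilting by this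
  functional concentrates the measures at the gradient. Exponential tightness follows by approximating
  \<open>X 1\<close> by simple functions, with errors that have small exponential moments of arbitrarily high
  order.\<close>

section \<open>The Hahn-Banach theorem and the variational principle of Ekeland\<close>

text \<open>In infinite dimension the lower bound cannot rely on relative interiors, and a minimiser
  of \<open>L - <., z>\<close> over the dual need not exist. Ekeland's principle needs only
  completeness of the dual and yields an almost-minimiser with almost vanishing gradient. For that
  gradient to be a point of the space and not merely of the bidual, the derivatives of
  \<open>L\<close> must be given by vectors; this is one use of the exponential moments of all
  orders. Directional derivatives suffice, because concentration is tested on a compact set, which
  finitely many half-spaces cover. For this, tightness must survive tilting, at the price of one
  more Chernoff estimate. All asymptotics are written as eventual inequalities between
  \<open>p n\<close> and \<open>exp (n * a)\<close> in \<open>ennreal\<close>, so that probabilities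
  equal to 0 and infinite rates need little separate treatment. Of the Hahn-Banach theorem only
  norming functionals are needed, and minimal sublinear functionals provide them without extending
  anything from subspaces.\<close>

definition sublinear :: "('b::real_vector \<Rightarrow> real) \<Rightarrow> bool" where
  "sublinear p \<longleftrightarrow> (\<forall>x y. p (x + y) \<le> p x + p y) \<and> (\<forall>c>0. \<forall>x. p (c *\<^sub>R x) = c * p x)"

lemma sublinear_0: "sublinear p \<Longrightarrow> p 0 = 0"
proof -
  assume "sublinear p"
  then have "p (2 *\<^sub>R 0) = 2 * p 0" unfolding sublinear_def by (meson zero_less_numeral)
  then show ?thesis by simp
qed

lemma sublinear_minus: "sublinear p \<Longrightarrow> - p (- x) \<le> p x"
proof -
  assume p: "sublinear p"
  then have "p (x + - x) \<le> p x + p (- x)" unfolding sublinear_def by blast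
  then show "- p (- x) \<le> p x" using sublinear_0[OF p] by simp
qed

lemma sublinear_scaleR: "sublinear p \<Longrightarrow> 0 \<le> c \<Longrightarrow> p (c *\<^sub>R x) = c * p x"
  by (cases "c = 0") (auto simp: sublinear_0, auto simp: sublinear_def)

text \<open>\<open>r\<close> is the largest sublinear functional below \<open>q\<close> with
  \<open>r (- y) \<le> - q y\<close>, so the tilt forces linearity along \<open>y\<close>. It is
  used twice: to prescribe the value at a vector, and to show that a minimal functional is
  additive.\<close>

lemma sublinear_tilt:
  fixes q :: "'b::real_vector \<Rightarrow> real"
  assumes q: "sublinear q"
  obtains r where "sublinear r" "\<And>x t. 0 \<le> t \<Longrightarrow> r x \<le> q (x + t *\<^sub>R y) - t * q y" "\<And>x. r x \<le> q x"
proof -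
  define r where "r x = (INF t\<in>{0..}. q (x + t *\<^sub>R y) - t * q y)" for x
  have lb: "- q (- x) \<le> q (x + t *\<^sub>R y) - t * q y" if "0 \<le> t" for x t
  proof -
    have "q (t *\<^sub>R y) = q ((x + t *\<^sub>R y) + (- x))" by simp
    also have "\<dots> \<le> q (x + t *\<^sub>R y) + q (- x)" using q unfolding sublinear_def by blast
    finally show ?thesis using sublinear_scaleR[OF q that] by simp
  qed
  have bdd: "bdd_below ((\<lambda>t. q (x + t *\<^sub>R y) - t * q y) ` {0..})" for x
    using lb by (intro bdd_belowI2) auto
  have le: "r x \<le> q (x + t *\<^sub>R y) - t * q y" if "0 \<le> t" for x t
    unfolding r_def using that by (intro cINF_lower bdd) auto
  have ge: "a \<le> r x" if "\<And>t. 0 \<le> t \<Longrightarrow> a \<le> q (x + t *\<^sub>R y) - t * q y" for a x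
    unfolding r_def using that by (intro cINF_greatest) auto
  have add: "r (x + z) \<le> r x + r z" for x z
  proof -
    have "r (x + z) - (q (z + s *\<^sub>R y) - s * q y) \<le> r x" if s: "0 \<le> s" for s
    proof (rule ge)
      fix t :: real assume t: "0 \<le> t"
      have "r (x + z) \<le> q ((x + z) + (t + s) *\<^sub>R y) - (t + s) * q y" using s t by (intro le) auto
      also have "(x + z) + (t + s) *\<^sub>R y = (x + t *\<^sub>R y) + (z + s *\<^sub>R y)" by (simp add: algebra_simps)
      also have "q \<dots> \<le> q (x + t *\<^sub>R y) + q (z + s *\<^sub>R y)" using q unfolding sublinear_def by blast
      finally show "r (x + z) - (q (z + s *\<^sub>R y) - s * q y) \<le> q (x + t *\<^sub>R y) - t * q y"
        by (simp add: algebra_simps)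
    qed
    then have "r (x + z) - r x \<le> r z" by (intro ge) (simp add: diff_le_eq le_diff_eq algebra_simps)
    then show ?thesis by simp
  qed
  have hom1: "c * r x \<le> r (c *\<^sub>R x)" if c: "0 < c" for c x
  proof (rule ge)
    fix t :: real assume t: "0 \<le> t"
    have "r x \<le> q (x + (t / c) *\<^sub>R y) - (t / c) * q y" using c t by (intro le) auto
    then have "c * r x \<le> c * q (x + (t / c) *\<^sub>R y) - t * q y"
      using c by (simp add: field_simps)
    also have "c * q (x + (t / c) *\<^sub>R y) = q (c *\<^sub>R (x + (t / c) *\<^sub>R y))"
      using q c unfolding sublinear_def by simp
    also have "c *\<^sub>R (x + (t / c) *\<^sub>R y) = c *\<^sub>R x + t *\<^sub>R y" using c by (simp add: algebra_simps)
    finally show "c * r x \<le> q (c *\<^sub>R x + t *\<^sub>R y) - t * q y" .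
  qed
  have hom: "r (c *\<^sub>R x) = c * r x" if c: "0 < c" for c x
  proof (rule antisym[OF _ hom1[OF c]])
    have "(1 / c) * r (c *\<^sub>R x) \<le> r ((1 / c) *\<^sub>R (c *\<^sub>R x))" using c by (intro hom1) auto
    then show "r (c *\<^sub>R x) \<le> c * r x" using c by (simp add: field_simps)
  qed
  show ?thesis
    using that[of r] add hom le le[of 0] unfolding sublinear_def by auto
qed

text \<open>Subadditivity needs the chain: of two members, the smaller one bounds both summands. The
  infimum is finite because every member lies above \<open>- p (- x)\<close>.\<close>

lemma sublinear_INF_chain:
  fixes p :: "'b::real_vector \<Rightarrow> real"
  assumes "C \<noteq> {}" and sub: "\<And>q. q \<in> C \<Longrightarrow> sublinear q \<and> (\<forall>x. q x \<le> p x)"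
    and total: "\<And>q r. q \<in> C \<Longrightarrow> r \<in> C \<Longrightarrow> (\<forall>x. q x \<le> r x) \<or> (\<forall>x. r x \<le> q x)"
  obtains u where "sublinear u" "\<And>q x. q \<in> C \<Longrightarrow> u x \<le> q x"
proof -
  define u where "u x = (INF q\<in>C. q x)" for x
  have bdd: "bdd_below ((\<lambda>q. q x) ` C)" for x
  proof (rule bdd_belowI2)
    fix q assume "q \<in> C"
    then show "- p (- x) \<le> q x" using sub[of q] sublinear_minus[of q x] by (smt (verit))
  qed
  have le: "u x \<le> q x" if "q \<in> C" for q x
    unfolding u_def using that by (intro cINF_lower bdd)
  have ge: "a \<le> u x" if "\<And>q. q \<in> C \<Longrightarrow> a \<le> q x" for a x
    unfolding u_def using that \<open>C \<noteq> {}\<close> by (intro cINF_greatest) auto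
  have add: "u (x + y) \<le> u x + u y" for x y
  proof -
    have "u (x + y) - r y \<le> u x" if r: "r \<in> C" for r
    proof (rule ge)
      fix q assume qC: "q \<in> C"
      have "u (x + y) \<le> q x + q y" "u (x + y) \<le> r x + r y"
        using le[OF qC, of "x + y"] le[OF r, of "x + y"] sub[OF qC] sub[OF r]
        unfolding sublinear_def by (blast intro: order_trans)+
      then show "u (x + y) - r y \<le> q x"
        using total[OF qC r] by (elim disjE) (drule spec[of _ y] spec[of _ x], linarith)+
    qed
    then have "u (x + y) - u x \<le> u y" by (intro ge) (simp add: diff_le_eq add.commute)
    then show ?thesis by simp
  qed
  have hom1: "c * u x \<le> u (c *\<^sub>R x)" if c: "0 < c" for c x
  proof (rule ge)
    fix q assume qC: "q \<in> C"
    have "c * u x \<le> c * q x" using le[OF qC] c by simp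
    also have "\<dots> = q (c *\<^sub>R x)" using sub[OF qC] c unfolding sublinear_def by simp
    finally show "c * u x \<le> q (c *\<^sub>R x)" .
  qed
  have hom: "u (c *\<^sub>R x) = c * u x" if c: "0 < c" for c x
  proof (rule antisym[OF _ hom1[OF c]])
    have "(1 / c) * u (c *\<^sub>R x) \<le> u ((1 / c) *\<^sub>R (c *\<^sub>R x))" using c by (intro hom1) auto
    then show "u (c *\<^sub>R x) \<le> c * u x" using c by (simp add: field_simps)
  qed
  show ?thesis
    using that[of u] add hom le unfolding sublinear_def by auto
qed

text \<open>Zorn's lemma for the reversed pointwise order \<open>P\<close>, whose maximal elements
  are the minimal functionals. The empty chain is bounded by \<open>p\<close> itself.\<close>

lemma minimal_sublinear:
  fixes p :: "'b::real_vector \<Rightarrow> real"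
  assumes p: "sublinear p"
  obtains m where "sublinear m" "\<And>x. m x \<le> p x"
    "\<And>r. sublinear r \<Longrightarrow> (\<And>x. r x \<le> m x) \<Longrightarrow> r = m"
proof -
  define A where "A = {q. sublinear q \<and> (\<forall>x. q x \<le> p x)}"
  define P where "P q r \<longleftrightarrow> (\<forall>x. r x \<le> q x)" for q r :: "'b \<Rightarrow> real"
  have "\<exists>m\<in>A. \<forall>a\<in>A. P m a \<longrightarrow> a = m"
  proof (rule predicate_Zorn)
    have "P q r \<Longrightarrow> P r q \<Longrightarrow> q = r" "P q r \<Longrightarrow> P r s \<Longrightarrow> P q s" for q r s
      unfolding P_def by (auto intro!: ext antisym) (meson order_trans)
    moreover have "P q q" for q unfolding P_def by simp
    ultimately show "partial_order_on A (relation_of P A)"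
      by (intro partial_order_on_relation_ofI) auto
  next
    fix C assume C: "C \<in> Chains (relation_of P A)"
    then have sub: "C \<subseteq> A" and tot: "\<And>q r. q \<in> C \<Longrightarrow> r \<in> C \<Longrightarrow> P q r \<or> P r q"
      unfolding Chains_def relation_of_def by auto
    show "\<exists>u\<in>A. \<forall>a\<in>C. P a u"
    proof (cases "C = {}")
      case True
      have "p \<in> A" using p unfolding A_def by simp
      with True show ?thesis by auto
    next
      case False
      obtain u where u: "sublinear u" "\<And>q x. q \<in> C \<Longrightarrow> u x \<le> q x"
        using sublinear_INF_chain[OF False, of p] sub tot unfolding A_def P_def by blast
      obtain q where "q \<in> C" using False by blast
      then have "\<forall>x. u x \<le> p x" using u(2) sub unfolding A_def by (blast intro: order_trans)
      then have "u \<in> A" using u(1) unfolding A_def by simp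
      with u show ?thesis unfolding P_def by auto
    qed
  qed
  then obtain m where m: "m \<in> A" "\<And>a. a \<in> A \<Longrightarrow> P m a \<Longrightarrow> a = m" by blast
  have "r = m" if "sublinear r" "\<And>x. r x \<le> m x" for r
  proof (rule m(2))
    have "\<forall>x. r x \<le> p x" using that(2) m(1) unfolding A_def by (blast intro: order_trans)
    then show "r \<in> A" using that(1) unfolding A_def by simp
    show "P m r" using that(2) unfolding P_def by simp
  qed
  then show ?thesis using that[of m] m(1) unfolding A_def by blast
qed

text \<open>A minimal sublinear functional \<open>m\<close> is linear: tilting it in a direction \<open>y\<close> can only decrease it.\<close>

lemma Hahn_Banach_norming:
  fixes v :: "'b::real_normed_vector"
  obtains \<theta> :: "'b \<Rightarrow>\<^sub>L real" where "\<And>x. blinfun_apply \<theta> x \<le> norm x" "blinfun_apply \<theta> v = norm v"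
proof -
  have "sublinear (norm :: 'b \<Rightarrow> real)" unfolding sublinear_def by (auto simp: norm_triangle_ineq)
  \<comment> \<open>Tilting the norm along \<open>v\<close> gives
    \<open>p (- v) \<le> - norm v\<close>, so every linear functional below \<open>p\<close> attains
    the norm at \<open>v\<close>.\<close>
  from sublinear_tilt[OF this, of v] obtain p where
    p: "sublinear p" "\<And>x t. 0 \<le> t \<Longrightarrow> p x \<le> norm (x + t *\<^sub>R v) - t * norm v" "\<And>x. p x \<le> norm x" by metis
  obtain m where m: "sublinear m" "\<And>x. m x \<le> p x"
    "\<And>r. sublinear r \<Longrightarrow> (\<And>x. r x \<le> m x) \<Longrightarrow> r = m" using minimal_sublinear[OF p(1)] by metis
  have add: "m (x + y) = m x + m y" for x y
  proof -
    obtain r where r: "sublinear r" "\<And>x t. 0 \<le> t \<Longrightarrow> r x \<le> m (x + t *\<^sub>R y) - t * m y" "\<And>x. r x \<le> m x"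
      using sublinear_tilt[OF m(1), of y] by metis
    have "r = m" by (intro m(3) r)
    then have "m x \<le> m (x + y) - m y" using r(2)[of 1 x] by simp
    moreover have "m (x + y) \<le> m x + m y" using m(1) unfolding sublinear_def by blast
    ultimately show ?thesis by simp
  qed
  have minus: "m (- x) = - m x" for x
    using add[of x "- x"] sublinear_0[OF m(1)] by simp
  have scale: "m (c *\<^sub>R x) = c * m x" for c x
  proof (cases "0 \<le> c")
    case True then show ?thesis by (rule sublinear_scaleR[OF m(1)])
  next
    case False
    then have "m (- ((- c) *\<^sub>R x)) = - ((- c) * m x)"
      using sublinear_scaleR[OF m(1), of "- c" x] unfolding minus by simp
    then show ?thesis by simp
  qed
  have le: "m x \<le> norm x" for x using m(2)[of x] p(3)[of x] by linarith
  have "bounded_linear m"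
  proof (rule bounded_linear_intro[where K=1])
    fix x show "norm (m x) \<le> norm x * 1" using le[of x] le[of "- x"] minus[of x] by auto
  qed (auto simp: add scale)
  moreover have "m v = norm v"
    using le[of v] m(2)[of "- v"] p(2)[of 1 "- v"] minus[of v] by simp
  ultimately show ?thesis using that[of "Blinfun m"] le by (simp add: bounded_linear_Blinfun_apply)
qed

text \<open>Test with a norming functional, whose norm is at most 1. This turns directional
  estimates for a gradient into a distance in the space.\<close>

lemma norm_le_if_functionals_le:
  fixes v :: "'b::real_normed_vector"
  assumes "\<And>\<theta> :: 'b \<Rightarrow>\<^sub>L real. blinfun_apply \<theta> v \<le> \<epsilon> * norm \<theta>" "0 \<le> \<epsilon>"
  shows "norm v \<le> \<epsilon>"
proof -
  obtain \<theta> :: "'b \<Rightarrow>\<^sub>L real" where \<theta>: "\<And>x. blinfun_apply \<theta> x \<le> norm x" "blinfun_apply \<theta> v = norm v"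
    using Hahn_Banach_norming[of v] by metis
  have "norm \<theta> \<le> 1"
  proof (rule norm_blinfun_bound)
    fix x show "norm (blinfun_apply \<theta> x) \<le> 1 * norm x"
      using \<theta>(1)[of x] \<theta>(1)[of "- x"] by (auto simp: blinfun.minus_right)
  qed simp
  then have "\<epsilon> * norm \<theta> \<le> \<epsilon>" using assms(2) by (simp add: mult_left_le)
  with assms(1)[of \<theta>] \<theta>(2) show ?thesis by simp
qed

text \<open>\<open>T x\<close> collects the points at which \<open>f\<close> has dropped from
  \<open>f x\<close> by at least \<open>\<epsilon>\<close> times the distance to \<open>x\<close>.
  Along a greedy sequence these closed sets are nested with diameters tending to 0, and from their
  common point no further descent is possible.\<close>

lemma Ekeland_variational_principle:
  fixes f :: "'c::complete_space \<Rightarrow> real"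
  assumes cont: "continuous_on UNIV f" and lb: "\<And>x. B \<le> f x" and \<epsilon>: "0 < \<epsilon>"
  obtains x where "f x + \<epsilon> * dist x x0 \<le> f x0" "\<And>y. f x \<le> f y + \<epsilon> * dist y x"
proof -
  define T where "T x = {y. f y + \<epsilon> * dist y x \<le> f x}" for x
  have T_refl: "x \<in> T x" for x unfolding T_def by simp
  have T_trans: "z \<in> T x" if "y \<in> T x" "z \<in> T y" for x y z
  proof -
    have "\<epsilon> * dist z x \<le> \<epsilon> * (dist z y + dist y x)"
      using \<epsilon> by (intro mult_left_mono dist_triangle) auto
    then show ?thesis using that unfolding T_def by (auto simp: algebra_simps)
  qed
  have closed_T: "closed (T x)" for x
    unfolding T_def by (intro closed_Collect_le continuous_intros cont)
  have bdd: "bdd_below (f ` A)" for A using lb by (auto intro!: bdd_belowI2)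
  have "\<exists>y\<in>T x. f y < Inf (f ` T x) + (1/2) ^ k" for x and k :: nat
    using cINF_less_iff[OF _ bdd, of "T x" "Inf (f ` T x) + (1/2) ^ k"] T_refl[of x] by auto
  then obtain g where g: "\<And>x k. g x k \<in> T x" "\<And>x k. f (g x k) < Inf (f ` T x) + (1/2) ^ k" by metis
  define s where "s = rec_nat x0 (\<lambda>k x. g x k)"
  have s0: "s 0 = x0" and sS: "s (Suc k) = g (s k) k" for k unfolding s_def by auto
  have s_mem: "s (k + j) \<in> T (s k)" for k j
    by (induction j) (auto simp: T_refl sS intro: T_trans g(1))
  \<comment> \<open>\<open>s (Suc k)\<close> is within \<open>(1/2) ^ k\<close> of the infimum of
    \<open>f\<close> over \<open>T (s k)\<close>, which contains \<open>T (s (Suc k))\<close>; so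
    this is all that \<open>f\<close> can still lose.\<close>
  have small: "\<epsilon> * dist y (s (Suc k)) \<le> (1/2) ^ k" if "y \<in> T (s (Suc k))" for y k
  proof -
    have "y \<in> T (s k)" using T_trans[OF g(1) that[unfolded sS]] .
    then have "Inf (f ` T (s k)) \<le> f y" by (intro cINF_lower bdd)
    with g(2)[of "s k" k] that show ?thesis unfolding sS T_def by auto
  qed
  have lim0: "(\<lambda>k. (1/2) ^ k / \<epsilon> :: real) \<longlonglongrightarrow> 0"
    by (intro tendsto_eq_intros LIMSEQ_realpow_zero) (use \<epsilon> in auto)
  have "Cauchy s"
  proof (rule metric_CauchyI)
    fix e :: real assume e: "0 < e"
    obtain k where k: "(1/2) ^ k / \<epsilon> < e / 2"
      using order_tendstoD(2)[OF lim0, of "e/2"] e by (auto simp: eventually_sequentially)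
    have d: "dist (s m) (s (Suc k)) < e / 2" if "m \<ge> Suc k" for m
    proof -
      have "\<epsilon> * dist (s m) (s (Suc k)) \<le> (1/2) ^ k" using s_mem[of "Suc k" "m - Suc k"] that by (intro small) auto
      then have "dist (s m) (s (Suc k)) \<le> (1/2) ^ k / \<epsilon>" using \<epsilon> by (simp add: field_simps)
      with k show ?thesis by linarith
    qed
    then show "\<exists>M. \<forall>m\<ge>M. \<forall>n\<ge>M. dist (s m) (s n) < e"
      by (meson dist_triangle_half_l)
  qed
  then obtain x where x: "s \<longlonglongrightarrow> x" using Cauchy_convergent convergent_def by blast
  have xT: "x \<in> T (s k)" for k
  proof (rule Lim_in_closed_set[OF closed_T _ _ x])
    show "\<forall>\<^sub>F n in sequentially. s n \<in> T (s k)"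
      unfolding eventually_sequentially using s_mem by (metis le_iff_add)
  qed simp
  \<comment> \<open>A violating \<open>y\<close> would belong to \<open>T x\<close>, hence to every
    \<open>T (s k)\<close>, and so have distance 0 from the limit \<open>x\<close>.\<close>
  have "f x \<le> f y + \<epsilon> * dist y x" for y
  proof (rule ccontr)
    assume "\<not> ?thesis"
    then have y: "y \<in> T x" "y \<noteq> x" unfolding T_def by auto
    have "dist y x \<le> 2 * ((1/2) ^ k / \<epsilon>)" for k
    proof -
      have "dist y (s (Suc k)) \<le> (1/2) ^ k / \<epsilon>" "dist x (s (Suc k)) \<le> (1/2) ^ k / \<epsilon>"
        using small[OF xT] small[OF T_trans[OF xT y(1)]] \<epsilon> by (auto simp: field_simps)
      then show ?thesis using dist_triangle2[of y x "s (Suc k)"] by linarith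
    qed
    then have "dist y x \<le> 2 * 0" by (intro LIMSEQ_le_const[OF tendsto_mult_left[OF lim0]]) auto
    with y(2) show False by simp
  qed
  moreover have "f x + \<epsilon> * dist x x0 \<le> f x0" using xT[of 0] unfolding s0 T_def by simp
  ultimately show ?thesis using that by blast
qed

section \<open>The Gaertner-Ellis theorem in Banach spaces\<close>

lemma scaled_ext_ln_le_iff:
  assumes "1 \<le> n"
  shows "ereal (1 / real n) * ext_ln p \<le> ereal a \<longleftrightarrow> p \<le> ennreal (exp (real n * a))"
proof (cases p)
  case (real r)
  show ?thesis
  proof (cases "r = 0")
    case True
    then show ?thesis using real assms by (simp add: ext_ln_def)
  next
    case False
    then have "0 < r" using real by simp
    then have "ereal (1 / real n) * ext_ln p \<le> ereal a \<longleftrightarrow> ln r \<le> real n * a"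
      using real assms by (simp add: ext_ln_def field_simps)
    also have "\<dots> \<longleftrightarrow> r \<le> exp (real n * a)"
      using \<open>0 < r\<close> by (metis exp_le_cancel_iff exp_ln)
    finally show ?thesis using real by simp
  qed
next
  case top
  then show ?thesis using assms by (simp add: ext_ln_def top_unique)
qed

text \<open>Like \<open>scaled_ext_ln_le_iff\<close>, this covers \<open>p = 0\<close> and
  \<open>p = \<infinity>\<close>, where \<open>ext_ln\<close> is infinite. \<open>n = 0\<close> is
  excluded because \<open>1 / real 0 = 0\<close> makes the left side independent of
  \<open>p\<close>.\<close>

lemma scaled_ext_ln_ge_iff:
  assumes "1 \<le> n"
  shows "ereal a \<le> ereal (1 / real n) * ext_ln p \<longleftrightarrow> ennreal (exp (real n * a)) \<le> p"
proof (cases p)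
  case (real r)
  show ?thesis
  proof (cases "r = 0")
    case True
    then show ?thesis using real assms by (simp add: ext_ln_def)
  next
    case False
    then have "0 < r" using real by simp
    then have "ereal a \<le> ereal (1 / real n) * ext_ln p \<longleftrightarrow> real n * a \<le> ln r"
      using real assms by (simp add: ext_ln_def field_simps)
    also have "\<dots> \<longleftrightarrow> exp (real n * a) \<le> r"
      using \<open>0 < r\<close> by (metis exp_le_cancel_iff exp_ln)
    finally show ?thesis using real by simp
  qed
next
  case top
  then show ?thesis using assms by (simp add: ext_ln_def)
qed

lemma scaled_ext_ln_tendstoD:
  assumes lim: "(\<lambda>n. ereal (1 / real n) * ext_ln (p n)) \<longlonglongrightarrow> ereal L" and "0 < \<epsilon>"
  shows "\<forall>\<^sub>F n in sequentially. p n \<le> ennreal (exp (real n * (L + \<epsilon>)))"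
    and "\<forall>\<^sub>F n in sequentially. ennreal (exp (real n * (L - \<epsilon>))) \<le> p n"
proof -
  have "\<forall>\<^sub>F n in sequentially. ereal (1 / real n) * ext_ln (p n) < ereal (L + \<epsilon>)"
    using \<open>0 < \<epsilon>\<close> by (intro order_tendstoD(2)[OF lim]) auto
  then show "\<forall>\<^sub>F n in sequentially. p n \<le> ennreal (exp (real n * (L + \<epsilon>)))"
    using eventually_ge_at_top[of 1]
    by eventually_elim (simp add: less_imp_le flip: scaled_ext_ln_le_iff)
  have "\<forall>\<^sub>F n in sequentially. ereal (L - \<epsilon>) < ereal (1 / real n) * ext_ln (p n)"
    using \<open>0 < \<epsilon>\<close> by (intro order_tendstoD(1)[OF lim]) auto
  then show "\<forall>\<^sub>F n in sequentially. ennreal (exp (real n * (L - \<epsilon>))) \<le> p n"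
    using eventually_ge_at_top[of 1]
    by eventually_elim (simp add: less_imp_le flip: scaled_ext_ln_ge_iff)
qed

text \<open>Quantifying over real \<open>a\<close> below \<open>L\<close> lets an infinite
  \<open>L\<close> pass without a separate case: if the inequality failed, a real number would lie
  strictly between its two sides.\<close>

lemma limsup_scaled_ext_ln_le:
  assumes "\<And>a. ereal a < L \<Longrightarrow> \<forall>\<^sub>F n in sequentially. p n \<le> ennreal (exp (- (real n * a)))"
  shows "limsup (\<lambda>n. ereal (1 / real n) * ext_ln (p n)) \<le> - L"
proof (rule ccontr)
  assume "\<not> ?thesis"
  then obtain r where r: "- L < ereal r" "ereal r < limsup (\<lambda>n. ereal (1 / real n) * ext_ln (p n))"
    using ereal_dense2 by (meson not_le)
  have "ereal (- r) < L" using r(1) by (metis ereal_uminus_less_reorder uminus_ereal.simps(1))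
  from assms[OF this] have "\<forall>\<^sub>F n in sequentially. ereal (1 / real n) * ext_ln (p n) \<le> ereal r"
    using eventually_ge_at_top[of 1] by eventually_elim (simp add: scaled_ext_ln_le_iff)
  then have "limsup (\<lambda>n. ereal (1 / real n) * ext_ln (p n)) \<le> ereal r" by (rule Limsup_bounded)
  with r(2) show False by simp
qed

lemma liminf_scaled_ext_ln_ge:
  assumes "\<And>a. L < ereal a \<Longrightarrow> \<forall>\<^sub>F n in sequentially. ennreal (exp (- (real n * a))) \<le> p n"
  shows "- L \<le> liminf (\<lambda>n. ereal (1 / real n) * ext_ln (p n))"
proof (rule ccontr)
  assume "\<not> ?thesis"
  then obtain r where r: "liminf (\<lambda>n. ereal (1 / real n) * ext_ln (p n)) < ereal r" "ereal r < - L"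
    using ereal_dense2 by (meson not_le)
  have "L < ereal (- r)" using r(2) by (simp add: ereal_less_uminus_reorder)
  from assms[OF this] have "\<forall>\<^sub>F n in sequentially. ereal r \<le> ereal (1 / real n) * ext_ln (p n)"
    using eventually_ge_at_top[of 1] by eventually_elim (simp add: scaled_ext_ln_ge_iff)
  then have "ereal r \<le> liminf (\<lambda>n. ereal (1 / real n) * ext_ln (p n))" by (rule Liminf_bounded)
  with r(1) show False by simp
qed

text \<open>Of two exponentially small terms the larger decides: with \<open>d\<close> the gap in
  the exponents, \<open>exp (n * d)\<close> eventually absorbs the factor 2.\<close>

lemma eventually_exp_add_le:
  assumes "a < b" "a < c"
  shows "\<forall>\<^sub>F n in sequentially. ennreal (exp (- (real n * b))) + ennreal (exp (- (real n * c)))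
    \<le> ennreal (exp (- (real n * a)))"
proof -
  define d where "d = min b c - a"
  have d: "0 < d" using assms unfolding d_def by simp
  have "\<forall>\<^sub>F n in sequentially. ln 2 / d \<le> real n"
    using filterlim_real_sequentially unfolding filterlim_at_top by blast
  then show ?thesis
  proof eventually_elim
    case (elim n)
    then have "ln 2 \<le> real n * d" using d by (simp add: field_simps)
    then have "2 \<le> exp (real n * d)" using exp_le_cancel_iff[of "ln 2" "real n * d"] by simp
    then have "2 * exp (- (real n * (a + d))) \<le> exp (real n * d) * exp (- (real n * (a + d)))"
      by (intro mult_right_mono) auto
    also have "\<dots> = exp (- (real n * a))" by (simp add: exp_add[symmetric] algebra_simps)
    finally have *: "2 * exp (- (real n * (a + d))) \<le> exp (- (real n * a))" .
    have "a + d \<le> b" "a + d \<le> c" unfolding d_def by auto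
    then have "exp (- (real n * b)) \<le> exp (- (real n * (a + d)))"
      "exp (- (real n * c)) \<le> exp (- (real n * (a + d)))"
      by (auto intro: mult_left_mono)
    with * have "exp (- (real n * b)) + exp (- (real n * c)) \<le> exp (- (real n * a))" by linarith
    then show ?case by (simp flip: ennreal_plus)
  qed
qed

section \<open>Chernoff bounds on half-spaces and compact sets\<close>

lemma exponential_Markov:
  fixes \<psi> :: "'e::{real_normed_vector, second_countable_topology} \<Rightarrow>\<^sub>L real" and c s :: real
  assumes sets: "sets Q = sets borel" and U: "U \<in> sets borel"
    and le: "\<And>z. z \<in> U \<Longrightarrow> c \<le> blinfun_apply \<psi> z" and s: "0 \<le> s"
  shows "emeasure Q U \<le> ennreal (exp (- (s * c))) * (\<integral>\<^sup>+z. ennreal (exp (s * blinfun_apply \<psi> z)) \<partial>Q)"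
proof -
  have meas [measurable]: "blinfun_apply \<psi> \<in> borel_measurable Q"
    unfolding measurable_cong_sets[OF sets refl]
    by (intro borel_measurable_continuous_onI) (intro continuous_intros)
  have [measurable]: "U \<in> sets Q" using U sets by simp
  have "emeasure Q U = (\<integral>\<^sup>+z. indicator U z \<partial>Q)" by simp
  also have "\<dots> \<le> (\<integral>\<^sup>+z. ennreal (exp (- (s * c))) * ennreal (exp (s * blinfun_apply \<psi> z)) \<partial>Q)"
  proof (intro nn_integral_mono)
    fix z
    have "1 \<le> exp (- (s * c)) * exp (s * blinfun_apply \<psi> z)" if "z \<in> U"
      using le[OF that] s by (simp add: exp_add[symmetric] mult_left_mono)
    then show "indicator U z \<le> ennreal (exp (- (s * c))) * ennreal (exp (s * blinfun_apply \<psi> z))"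
      by (auto simp: indicator_def simp flip: ennreal_mult')
  qed
  also have "\<dots> = ennreal (exp (- (s * c))) * (\<integral>\<^sup>+z. ennreal (exp (s * blinfun_apply \<psi> z)) \<partial>Q)"
    by (intro nn_integral_cmult) measurable
  finally show ?thesis .
qed

text \<open>Every point of \<open>K\<close> lies in an open half-space whose Chernoff bound has a
  rate above \<open>a\<close>, and finitely many of these cover \<open>K\<close>. \<open>Q\<close>
  and \<open>G\<close> are general because the lemma serves the original measures, with
  \<open>G = L\<close>, and the tilted ones, with \<open>L\<close> shifted by the tilting
  functional.\<close>

lemma compact_exponential_bound:
  fixes Q :: "nat \<Rightarrow> 'e::{real_normed_vector, second_countable_topology} measure"
    and G :: "('e \<Rightarrow>\<^sub>L real) \<Rightarrow> real"
  assumes sets: "\<And>n. sets (Q n) = sets borel"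
    and mgf: "\<And>\<psi> \<epsilon>. 0 < \<epsilon> \<Longrightarrow> \<forall>\<^sub>F n in sequentially.
      (\<integral>\<^sup>+z. ennreal (exp (real n * blinfun_apply \<psi> z)) \<partial>Q n) \<le> ennreal (exp (real n * (G \<psi> + \<epsilon>)))"
    and "compact K" and sep: "\<And>z. z \<in> K \<Longrightarrow> \<exists>\<psi>. a < blinfun_apply \<psi> z - G \<psi>"
  obtains b where "a < b" "\<forall>\<^sub>F n in sequentially. emeasure (Q n) K \<le> ennreal (exp (- (real n * b)))"
proof -
  define R where "R U \<longleftrightarrow> open U \<and> (\<exists>b>a. \<forall>\<^sub>F n in sequentially.
    emeasure (Q n) U \<le> ennreal (exp (- (real n * b))))" for U
  have nbhd: "\<exists>U. R U \<and> z \<in> U" if "z \<in> K" for z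
  proof -
    obtain \<psi> where \<psi>: "a < blinfun_apply \<psi> z - G \<psi>" using sep \<open>z \<in> K\<close> by blast
    \<comment> \<open>The surplus \<open>d\<close> is split: a quarter goes into opening the
      half-space around \<open>z\<close>, a quarter into the error of the moment bound, and half
      remains.\<close>
    define d where "d = blinfun_apply \<psi> z - G \<psi> - a"
    define c where "c = a + 3 * d / 4 + G \<psi>"
    define U where "U = {w. c < blinfun_apply \<psi> w}"
    have d: "0 < d" using \<psi> unfolding d_def by simp
    then have quarter: "0 < d / 4" by simp
    have "open U" unfolding U_def by (intro open_Collect_less continuous_intros)
    have "z \<in> U" using d unfolding U_def c_def by (simp add: d_def field_simps)
    have "\<forall>\<^sub>F n in sequentially. emeasure (Q n) U \<le> ennreal (exp (- (real n * (a + d / 2))))"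
      using mgf[of "d/4" \<psi>, OF quarter]
    proof eventually_elim
      case (elim n)
      have "emeasure (Q n) U \<le> ennreal (exp (- (real n * c))) *
          (\<integral>\<^sup>+z. ennreal (exp (real n * blinfun_apply \<psi> z)) \<partial>Q n)"
        using \<open>open U\<close> by (intro exponential_Markov sets) (auto simp: U_def)
      also have "\<dots> \<le> ennreal (exp (- (real n * c))) * ennreal (exp (real n * (G \<psi> + d / 4)))"
        by (intro mult_left_mono elim) simp
      also have "\<dots> = ennreal (exp (- (real n * (a + d / 2))))"
        by (simp add: c_def exp_add[symmetric] ennreal_mult'[symmetric] algebra_simps)
      finally show ?case .
    qed
    moreover have "a < a + d / 2" using d by simp
    ultimately have "R U" unfolding R_def using \<open>open U\<close> by blast
    with \<open>z \<in> U\<close> show ?thesis by blast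
  qed
  have union: "R (\<Union>D)" if "finite D" "D \<subseteq> Collect R" for D
    using that
  proof (induction D rule: finite_induct)
    case empty
    show ?case unfolding R_def by (auto intro!: exI[of _ "a + 1"])
  next
    case (insert U D)
    then obtain b c where b: "a < b" "\<forall>\<^sub>F n in sequentially. emeasure (Q n) U \<le> ennreal (exp (- (real n * b)))"
      and c: "a < c" "\<forall>\<^sub>F n in sequentially. emeasure (Q n) (\<Union>D) \<le> ennreal (exp (- (real n * c)))"
      and op: "open U" "open (\<Union>D)" unfolding R_def by auto
    \<comment> \<open>Each union lowers the rate, but \<open>e\<close> stays strictly above
      \<open>a\<close>; this is why \<open>R\<close> asks only for some
      \<open>b > a\<close>.\<close>
    define e where "e = (a + min b c) / 2"
    have e: "a < e" "e < b" "e < c" using b(1) c(1) unfolding e_def by (auto simp: min_def)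
    have "\<forall>\<^sub>F n in sequentially. emeasure (Q n) (\<Union>(insert U D)) \<le> ennreal (exp (- (real n * e)))"
      using b(2) c(2) eventually_exp_add_le[OF e(2,3)]
    proof eventually_elim
      case (elim n)
      have "emeasure (Q n) (U \<union> \<Union>D) \<le> emeasure (Q n) U + emeasure (Q n) (\<Union>D)"
        using op sets by (intro emeasure_subadditive) auto
      also have "\<dots> \<le> ennreal (exp (- (real n * b))) + ennreal (exp (- (real n * c)))"
        using elim by (intro add_mono) auto
      finally show ?case using elim(3) by (simp add: Un_commute)
    qed
    then show ?case unfolding R_def using op e(1) by auto
  qed
  have "K \<subseteq> \<Union>(Collect R)" using nbhd by auto
  moreover have "open U" if "U \<in> Collect R" for U using that unfolding R_def by simp
  ultimately obtain D where D: "D \<subseteq> Collect R" "finite D" "K \<subseteq> \<Union>D"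
    by (rule compactE[OF \<open>compact K\<close>])
  from union[OF D(2,1)] obtain b where op: "open (\<Union>D)" and b: "a < b"
    "\<forall>\<^sub>F n in sequentially. emeasure (Q n) (\<Union>D) \<le> ennreal (exp (- (real n * b)))"
    unfolding R_def by blast
  have "\<forall>\<^sub>F n in sequentially. emeasure (Q n) K \<le> ennreal (exp (- (real n * b)))"
    using b(2)
  proof eventually_elim
    case (elim n)
    have "emeasure (Q n) K \<le> emeasure (Q n) (\<Union>D)" by (intro emeasure_mono[OF D(3)]) (simp add: sets borel_open[OF op])
    with elim show ?case by simp
  qed
  with b(1) that show ?thesis by blast
qed

text \<open>Convergence of the scaled log-moment generating functions is split into two eventual
  bounds, so that the measure at index 0 has no influence on them. \<open>gradient_L\<close> asks
  for directional derivatives, all represented by one vector of the space.\<close>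

locale gartner_ellis =
  fixes \<mu> :: "nat \<Rightarrow> 'e::{banach, second_countable_topology} measure"
    and L :: "('e \<Rightarrow>\<^sub>L real) \<Rightarrow> real"
  assumes sets_mu: "\<And>n. sets (\<mu> n) = sets borel"
    and mgf_upper: "\<And>\<psi> \<epsilon>. 0 < \<epsilon> \<Longrightarrow> \<forall>\<^sub>F n in sequentially.
      (\<integral>\<^sup>+z. ennreal (exp (real n * blinfun_apply \<psi> z)) \<partial>\<mu> n) \<le> ennreal (exp (real n * (L \<psi> + \<epsilon>)))"
    and mgf_lower: "\<And>\<psi> \<epsilon>. 0 < \<epsilon> \<Longrightarrow> \<forall>\<^sub>F n in sequentially.
      ennreal (exp (real n * (L \<psi> - \<epsilon>))) \<le> (\<integral>\<^sup>+z. ennreal (exp (real n * blinfun_apply \<psi> z)) \<partial>\<mu> n)"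
    and exponentially_tight: "\<And>a. \<exists>K. compact K \<and>
      (\<forall>\<^sub>F n in sequentially. emeasure (\<mu> n) (- K) \<le> ennreal (exp (- (real n * a))))"
    and continuous_L: "continuous_on UNIV L"
    and gradient_L: "\<And>\<psi>. \<exists>x. \<forall>\<phi>. ((\<lambda>t. L (\<psi> + t *\<^sub>R \<phi>)) has_real_derivative blinfun_apply \<phi> x) (at 0)"
begin

lemma closed_upper_bound:
  assumes "closed C" "ereal a < (INF x\<in>C. dual_conjugate L x)"
  shows "\<forall>\<^sub>F n in sequentially. emeasure (\<mu> n) C \<le> ennreal (exp (- (real n * a)))"
proof -
  obtain K where K: "compact K"
    "\<forall>\<^sub>F n in sequentially. emeasure (\<mu> n) (- K) \<le> ennreal (exp (- (real n * (a + 1))))"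
    using exponentially_tight by blast
  have "\<exists>\<psi>. a < blinfun_apply \<psi> z - L \<psi>" if "z \<in> K \<inter> C" for z
  proof -
    have "ereal a < dual_conjugate L z"
      using assms(2) that by (auto intro: less_le_trans INF_lower)
    then show ?thesis unfolding dual_conjugate_def by (auto simp: less_SUP_iff)
  qed
  then obtain b where b: "a < b"
    "\<forall>\<^sub>F n in sequentially. emeasure (\<mu> n) (K \<inter> C) \<le> ennreal (exp (- (real n * b)))"
    using compact_exponential_bound[OF sets_mu mgf_upper compact_Int_closed[OF K(1) assms(1)]] by blast
  have "a < a + 1" by simp
  from K(2) b(2) eventually_exp_add_le[OF b(1) this] show ?thesis
  proof eventually_elim
    case (elim n)
    have "emeasure (\<mu> n) C \<le> emeasure (\<mu> n) ((K \<inter> C) \<union> - K)"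
      using sets_mu assms(1) compact_imp_closed[OF K(1)] by (intro emeasure_mono) auto
    also have "\<dots> \<le> emeasure (\<mu> n) (K \<inter> C) + emeasure (\<mu> n) (- K)"
      using sets_mu assms(1) compact_imp_closed[OF K(1)] by (intro emeasure_subadditive) auto
    also have "\<dots> \<le> ennreal (exp (- (real n * b))) + ennreal (exp (- (real n * (a + 1))))"
      using elim by (intro add_mono) auto
    finally show ?case using elim(3) by simp
  qed
qed

text \<open>Left unnormalised: the total mass is the moment generating function, about
  \<open>exp (n * L \<psi>)\<close>, so a set is negligible for the tilted measure once its rate
  exceeds \<open>- L \<psi>\<close>.\<close>

definition tilted :: "('e \<Rightarrow>\<^sub>L real) \<Rightarrow> nat \<Rightarrow> 'e measure" where
  "tilted \<psi> n = density (\<mu> n) (\<lambda>z. ennreal (exp (real n * blinfun_apply \<psi> z)))"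

lemma measurable_functional [measurable]: "blinfun_apply \<psi> \<in> borel_measurable (\<mu> n)"
  unfolding measurable_cong_sets[OF sets_mu refl]
  by (intro borel_measurable_continuous_onI) (intro continuous_intros)

lemma measurable_exp_functional:
  "(\<lambda>z. ennreal (exp (s * blinfun_apply \<psi> z))) \<in> borel_measurable (\<mu> n)"
  by measurable

lemma sets_tilted: "sets (tilted \<psi> n) = sets borel"
  unfolding tilted_def using sets_mu by simp

lemma emeasure_tilted:
  "A \<in> sets borel \<Longrightarrow> emeasure (tilted \<psi> n) A
    = (\<integral>\<^sup>+z. ennreal (exp (real n * blinfun_apply \<psi> z)) * indicator A z \<partial>\<mu> n)"
  unfolding tilted_def using sets_mu by (intro emeasure_density measurable_exp_functional) auto

lemma nn_integral_tilted:
  "(\<integral>\<^sup>+z. ennreal (exp (real n * blinfun_apply \<phi> z)) \<partial>tilted \<psi> n)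
    = (\<integral>\<^sup>+z. ennreal (exp (real n * blinfun_apply (\<psi> + \<phi>) z)) \<partial>\<mu> n)"
  unfolding tilted_def
  by (subst nn_integral_density)
    (auto intro!: nn_integral_cong
      simp: ennreal_mult'[symmetric] exp_add[symmetric] plus_blinfun.rep_eq algebra_simps)

text \<open>The density of the tilted measure may be unbounded, so tightness has to be transferred.
  The density is cut at \<open>exp (n * s)\<close>: the part below is paid for by a compact set with
  a higher rate, the part above by the moment generating function at
  \<open>2 *\<^sub>R \<psi>\<close>.\<close>

lemma tilted_tail:
  obtains K where "compact K"
    "\<forall>\<^sub>F n in sequentially. emeasure (tilted \<psi> n) (- K) \<le> ennreal (exp (- (real n * (1 - L \<psi>))))"
proof -
  \<comment> \<open>Chosen together with the rate of \<open>K\<close> so that each part is at most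
    \<open>exp (- n * (2 - L \<psi>))\<close>; the excess over \<open>1 - L \<psi>\<close> absorbs
    their sum.\<close>
  define s where "s = L (2 *\<^sub>R \<psi>) + 3 - L \<psi>"
  obtain K where K: "compact K"
    "\<forall>\<^sub>F n in sequentially. emeasure (\<mu> n) (- K) \<le> ennreal (exp (- (real n * (s - L \<psi> + 2))))"
    using exponentially_tight by blast
  have K_sets: "- K \<in> sets (\<mu> n)" for n using compact_imp_closed[OF K(1)] sets_mu by auto
  have lt: "1 - L \<psi> < 2 - L \<psi>" by simp
  have one: "0 < (1::real)" by simp
  have "\<forall>\<^sub>F n in sequentially. emeasure (tilted \<psi> n) (- K) \<le> ennreal (exp (- (real n * (1 - L \<psi>))))"
    using K(2) mgf_upper[OF one, of "2 *\<^sub>R \<psi>"] eventually_exp_add_le[OF lt lt]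
  proof eventually_elim
    case (elim n)
    have "emeasure (tilted \<psi> n) (- K)
        = (\<integral>\<^sup>+z. ennreal (exp (real n * blinfun_apply \<psi> z)) * indicator (- K) z \<partial>\<mu> n)"
      using compact_imp_closed[OF K(1)] by (intro emeasure_tilted) auto
    also have "\<dots> \<le> (\<integral>\<^sup>+z. ennreal (exp (real n * s)) * indicator (- K) z +
        ennreal (exp (- (real n * s))) * ennreal (exp (real n * blinfun_apply (2 *\<^sub>R \<psi>) z)) \<partial>\<mu> n)"
    proof (intro nn_integral_mono)
      fix z
      have "exp (real n * blinfun_apply \<psi> z) \<le>
          exp (real n * s) + exp (- (real n * s)) * exp (real n * blinfun_apply (2 *\<^sub>R \<psi>) z)"
      proof (cases "blinfun_apply \<psi> z \<le> s")
        case True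
        then have "exp (real n * blinfun_apply \<psi> z) \<le> exp (real n * s)" by (simp add: mult_left_mono)
        then show ?thesis by (smt (verit) exp_gt_zero mult_pos_pos)
      next
        case False
        then have "real n * blinfun_apply \<psi> z \<le> - (real n * s) + real n * blinfun_apply (2 *\<^sub>R \<psi>) z"
          using mult_left_mono[of s "blinfun_apply \<psi> z" "real n"]
          by (simp add: scaleR_blinfun.rep_eq algebra_simps)
        then have "exp (real n * blinfun_apply \<psi> z) \<le>
            exp (- (real n * s)) * exp (real n * blinfun_apply (2 *\<^sub>R \<psi>) z)"
          by (simp add: exp_add[symmetric])
        then show ?thesis by (smt (verit) exp_gt_zero)
      qed
      then show "ennreal (exp (real n * blinfun_apply \<psi> z)) * indicator (- K) z
          \<le> ennreal (exp (real n * s)) * indicator (- K) z +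
            ennreal (exp (- (real n * s))) * ennreal (exp (real n * blinfun_apply (2 *\<^sub>R \<psi>) z))"
        by (auto simp: indicator_def simp flip: ennreal_mult' ennreal_plus)
    qed
    also have "\<dots> = ennreal (exp (real n * s)) * emeasure (\<mu> n) (- K) + ennreal (exp (- (real n * s))) *
        (\<integral>\<^sup>+z. ennreal (exp (real n * blinfun_apply (2 *\<^sub>R \<psi>) z)) \<partial>\<mu> n)"
      using K_sets by (subst nn_integral_add)
        (auto intro!: measurable_exp_functional borel_measurable_times_ennreal
          simp: nn_integral_cmult_indicator nn_integral_cmult measurable_exp_functional)
    also have "\<dots> \<le> ennreal (exp (real n * s)) * ennreal (exp (- (real n * (s - L \<psi> + 2)))) +
        ennreal (exp (- (real n * s))) * ennreal (exp (real n * (L (2 *\<^sub>R \<psi>) + 1)))"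
      using elim(1,2) by (intro add_mono mult_left_mono) auto
    also have "\<dots> = ennreal (exp (- (real n * (2 - L \<psi>)))) + ennreal (exp (- (real n * (2 - L \<psi>))))"
      unfolding s_def by (simp add: ennreal_mult'[symmetric] exp_add[symmetric] algebra_simps)
    finally show ?case using elim(3) by simp
  qed
  with K(1) that show ?thesis by blast
qed

text \<open>For \<open>z\<close> other than \<open>x\<close> and \<open>\<phi>\<close> norming
  \<open>z - x\<close>, the difference of \<open>t * blinfun_apply \<phi> z\<close> and
  \<open>L (\<psi> + t *\<^sub>R \<phi>)\<close> has positive slope at \<open>t = 0\<close>, so it
  exceeds \<open>- L \<psi>\<close> for small \<open>t > 0\<close>. Hence the mass away from
  \<open>x\<close> is exponentially smaller than the total mass.\<close>

lemma tilted_concentration: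
  assumes x: "\<And>\<phi>. ((\<lambda>t. L (\<psi> + t *\<^sub>R \<phi>)) has_real_derivative blinfun_apply \<phi> x) (at 0)"
    and "0 < r" "0 < \<epsilon>"
  shows "\<forall>\<^sub>F n in sequentially. ennreal (exp (real n * (L \<psi> - \<epsilon>))) \<le> emeasure (tilted \<psi> n) (ball x r)"
proof -
  obtain K where K: "compact K"
    "\<forall>\<^sub>F n in sequentially. emeasure (tilted \<psi> n) (- K) \<le> ennreal (exp (- (real n * (1 - L \<psi>))))"
    by (rule tilted_tail)
  have "\<exists>\<phi>. - L \<psi> < blinfun_apply \<phi> z - L (\<psi> + \<phi>)" if z: "z \<in> K - ball x r" for z
  proof -
    obtain \<phi> :: "'e \<Rightarrow>\<^sub>L real" where \<phi>: "blinfun_apply \<phi> (z - x) = norm (z - x)"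
      using Hahn_Banach_norming[of "z - x"] by metis
    have "z \<noteq> x" using z \<open>0 < r\<close> by auto
    then have pos: "0 < blinfun_apply \<phi> z - blinfun_apply \<phi> x" using \<phi> by (simp add: blinfun.diff_right)
    have "((\<lambda>t. t * blinfun_apply \<phi> z - L (\<psi> + t *\<^sub>R \<phi>)) has_real_derivative
        blinfun_apply \<phi> z - blinfun_apply \<phi> x) (at 0)"
      by (auto intro!: derivative_eq_intros x)
    from DERIV_pos_inc_right[OF this pos] obtain d where d: "0 < d"
      "\<And>h. 0 < h \<Longrightarrow> h < d \<Longrightarrow> - L \<psi> < h * blinfun_apply \<phi> z - L (\<psi> + h *\<^sub>R \<phi>)" by auto
    have "- L \<psi> < (d / 2) * blinfun_apply \<phi> z - L (\<psi> + (d / 2) *\<^sub>R \<phi>)"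
      using d(1) by (intro d(2)) auto
    then show ?thesis
      by (intro exI[of _ "(d / 2) *\<^sub>R \<phi>"]) (simp add: scaleR_blinfun.rep_eq)
  qed
  moreover have "\<forall>\<^sub>F n in sequentially. (\<integral>\<^sup>+z. ennreal (exp (real n * blinfun_apply \<phi> z)) \<partial>tilted \<psi> n)
      \<le> ennreal (exp (real n * (L (\<psi> + \<phi>) + \<epsilon>)))" if "0 < \<epsilon>" for \<phi> \<epsilon>
    unfolding nn_integral_tilted using that by (rule mgf_upper)
  moreover have "compact (K - ball x r)" by (intro compact_diff K(1)) simp
  ultimately obtain b where b: "- L \<psi> < b"
    "\<forall>\<^sub>F n in sequentially. emeasure (tilted \<psi> n) (K - ball x r) \<le> ennreal (exp (- (real n * b)))"
    using compact_exponential_bound[of "tilted \<psi>" "\<lambda>\<phi>. L (\<psi> + \<phi>)" "K - ball x r" "- L \<psi>"] sets_tilted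
    by blast
  define c where "c = min b (1 - L \<psi>)"
  define c' where "c' = (c - L \<psi>) / 2"
  have c: "- L \<psi> < c" using b(1) unfolding c_def by simp
  then have c': "- L \<psi> < c'" "c' < b" "c' < 1 - L \<psi>" unfolding c'_def c_def by (auto simp: min_def split: if_splits)
  \<comment> \<open>The total mass is eventually at least
    \<open>exp (n * (L \<psi> - \<delta>))\<close>, and this \<open>\<delta>\<close> makes it exceed
    the claimed mass plus the bound \<open>?e\<close> for the complement of the ball;
    \<open>?e\<close> is then cancelled on both sides.\<close>
  define \<delta> where "\<delta> = min \<epsilon> (c' + L \<psi>) / 2"
  have \<delta>: "0 < \<delta>" "\<delta> - L \<psi> < c'" "\<delta> - L \<psi> < \<epsilon> - L \<psi>"
    using \<open>0 < \<epsilon>\<close> c'(1) unfolding \<delta>_def by (auto simp: min_def)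
  show ?thesis
    using K(2) b(2) eventually_exp_add_le[OF c'(2,3)] eventually_exp_add_le[OF \<delta>(3,2)]
      mgf_lower[OF \<delta>(1), of \<psi>]
  proof eventually_elim
    case (elim n)
    let ?B = "emeasure (tilted \<psi> n) (ball x r)" and ?e = "ennreal (exp (- (real n * c')))"
    have "ennreal (exp (- (real n * (\<epsilon> - L \<psi>)))) + ?e \<le> ennreal (exp (real n * (L \<psi> - \<delta>)))"
      using elim(4) by (simp add: algebra_simps)
    also have "\<dots> \<le> emeasure (tilted \<psi> n) UNIV"
      using elim(5) by (simp add: emeasure_tilted)
    also have "UNIV = ball x r \<union> ((K - ball x r) \<union> - K)" by auto
    also have "emeasure (tilted \<psi> n) \<dots> \<le> ?B + emeasure (tilted \<psi> n) ((K - ball x r) \<union> - K)"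
      using sets_tilted compact_imp_closed[OF K(1)] by (intro emeasure_subadditive) auto
    also have "\<dots> \<le> ?B + (emeasure (tilted \<psi> n) (K - ball x r) + emeasure (tilted \<psi> n) (- K))"
      using sets_tilted compact_imp_closed[OF K(1)] by (intro add_left_mono emeasure_subadditive) auto
    also have "\<dots> \<le> ?B + (ennreal (exp (- (real n * b))) + ennreal (exp (- (real n * (1 - L \<psi>)))))"
      using elim by (intro add_left_mono add_mono) auto
    also have "\<dots> \<le> ?B + ?e" using elim by (intro add_left_mono) auto
    finally have "ennreal (exp (- (real n * (\<epsilon> - L \<psi>)))) \<le> ?B"
      by (simp add: add.commute[of _ ?e] ennreal_add_left_cancel_le)
    then show ?case by (simp add: algebra_simps)
  qed
qed

text \<open>Exposed points are found by minimising \<open>L - \<langle>\<cdot>, z\<rangle>\<close> up to \<open>\<epsilon> * norm\<close> (the idea of the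
  Broendsted-Rockafellar theorem): the gradient there is within \<open>\<epsilon>\<close> of \<open>z\<close>.\<close>

lemma exposed_point_near:
  assumes "dual_conjugate L z < ereal a" "0 < \<epsilon>"
  obtains \<psi> x where "\<And>\<phi>. ((\<lambda>t. L (\<psi> + t *\<^sub>R \<phi>)) has_real_derivative blinfun_apply \<phi> x) (at 0)"
    "dist x z \<le> \<epsilon>" "blinfun_apply \<psi> x - L \<psi> < a"
proof -
  have conj_ge: "ereal (blinfun_apply \<psi> z - L \<psi>) \<le> dual_conjugate L z" for \<psi>
    unfolding dual_conjugate_def by (rule SUP_upper) simp
  obtain v where v: "dual_conjugate L z = ereal v"
    using assms(1) conj_ge[of 0] by (cases "dual_conjugate L z") auto
  have va: "v < a" using assms(1) v by simp
  define f where "f \<psi> = L \<psi> - blinfun_apply \<psi> z" for \<psi>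
  have lb: "- v \<le> f \<psi>" for \<psi> using conj_ge[of \<psi>] v unfolding f_def by simp
  define \<delta> where "\<delta> = (a - v) / 3"
  have \<delta>: "0 < \<delta>" using va unfolding \<delta>_def by simp
  have "ereal (v - \<delta>) < dual_conjugate L z" using v \<delta> by simp
  then obtain \<psi>1 where "v - \<delta> < blinfun_apply \<psi>1 z - L \<psi>1"
    unfolding dual_conjugate_def by (auto simp: less_SUP_iff)
  then have \<psi>1: "f \<psi>1 < - v + \<delta>" unfolding f_def by simp
  \<comment> \<open>The slope \<open>e\<close> is chosen after \<open>\<psi>1\<close>:
    \<open>blinfun_apply \<psi> x - L \<psi>\<close> may exceed \<open>v\<close> by
    \<open>e * norm \<psi>\<close>, and \<open>norm \<psi>1\<close> is not controlled in
    advance.\<close>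
  define e where "e = min \<epsilon> (\<delta> / (1 + norm \<psi>1))"
  have e: "0 < e" "e \<le> \<epsilon>" using assms(2) \<delta> unfolding e_def by (auto intro!: divide_pos_pos add_pos_nonneg)
  have "e * (1 + norm \<psi>1) \<le> \<delta>"
    unfolding e_def by (metis min.cobounded2 pos_le_divide_eq add_pos_nonneg norm_ge_zero zero_less_one)
  then have e1: "e * norm \<psi>1 \<le> \<delta>" using e(1) by (simp add: algebra_simps)
  have "continuous_on UNIV f"
    unfolding f_def by (intro continuous_intros continuous_L)
  then obtain \<psi> where \<psi>: "f \<psi> + e * dist \<psi> \<psi>1 \<le> f \<psi>1" "\<And>\<phi>. f \<psi> \<le> f \<phi> + e * dist \<phi> \<psi>"
    using Ekeland_variational_principle[of f "- v" e \<psi>1] lb e(1) by blast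
  obtain x where x: "\<And>\<phi>. ((\<lambda>t. L (\<psi> + t *\<^sub>R \<phi>)) has_real_derivative blinfun_apply \<phi> x) (at 0)"
    using gradient_L by blast
  \<comment> \<open>Otherwise a short step along \<open>\<phi>\<close> would lower \<open>f\<close>
    by more than \<open>e\<close> times its length, contrary to Ekeland's choice of
    \<open>\<psi>\<close>.\<close>
  have "blinfun_apply \<phi> (z - x) \<le> e * norm \<phi>" for \<phi>
  proof (rule ccontr)
    assume "\<not> ?thesis"
    then have pos: "blinfun_apply \<phi> x - blinfun_apply \<phi> z + e * norm \<phi> < 0" by (simp add: blinfun.diff_right)
    have "((\<lambda>t. L (\<psi> + t *\<^sub>R \<phi>) - (blinfun_apply \<psi> z + t * blinfun_apply \<phi> z) + e * (t * norm \<phi>))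
        has_real_derivative blinfun_apply \<phi> x - blinfun_apply \<phi> z + e * norm \<phi>) (at 0)"
      by (auto intro!: derivative_eq_intros x)
    from DERIV_neg_dec_right[OF this pos] obtain d where d: "0 < d"
      "\<And>t. 0 < t \<Longrightarrow> t < d \<Longrightarrow>
        L (\<psi> + t *\<^sub>R \<phi>) - (blinfun_apply \<psi> z + t * blinfun_apply \<phi> z) + e * (t * norm \<phi>) < f \<psi>"
      unfolding f_def by auto
    have "f (\<psi> + (d / 2) *\<^sub>R \<phi>) + e * dist (\<psi> + (d / 2) *\<^sub>R \<phi>) \<psi> < f \<psi>"
      using d(2)[of "d / 2"] d(1)
      by (simp add: f_def dist_norm plus_blinfun.rep_eq scaleR_blinfun.rep_eq)
    with \<psi>(2)[of "\<psi> + (d / 2) *\<^sub>R \<phi>"] show False by simp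
  qed
  then have near: "norm (z - x) \<le> e" using e(1) by (intro norm_le_if_functionals_le) auto
  \<comment> \<open>\<open>f \<psi>1\<close> is within \<open>\<delta>\<close> of the lower bound of
    \<open>f\<close>, which limits how far Ekeland's point can be from
    \<open>\<psi>1\<close>.\<close>
  have "e * dist \<psi> \<psi>1 < \<delta>" using \<psi>(1) \<psi>1 lb[of \<psi>] by linarith
  moreover have "e * norm \<psi> \<le> e * dist \<psi> \<psi>1 + e * norm \<psi>1"
    using mult_left_mono[OF norm_triangle_sub[of \<psi> \<psi>1], of e] e(1) by (simp add: dist_norm algebra_simps)
  ultimately have "e * norm \<psi> < 2 * \<delta>" using e1 by linarith
  moreover have "blinfun_apply \<psi> (x - z) \<le> e * norm \<psi>"
  proof -
    have "blinfun_apply \<psi> (x - z) \<le> norm \<psi> * norm (x - z)"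
      using norm_blinfun[of \<psi> "x - z"] by simp
    also have "\<dots> \<le> norm \<psi> * e" using near by (intro mult_left_mono) (auto simp: norm_minus_commute)
    finally show ?thesis by (simp add: mult.commute)
  qed
  moreover have "blinfun_apply \<psi> x - L \<psi> = - f \<psi> + blinfun_apply \<psi> (x - z)"
    unfolding f_def by (simp add: blinfun.diff_right)
  moreover have "v + 3 * \<delta> = a" unfolding \<delta>_def by (simp add: field_simps)
  ultimately have "blinfun_apply \<psi> x - L \<psi> < a" using lb[of \<psi>] \<delta> by linarith
  moreover have "dist x z \<le> \<epsilon>" using near e(2) by (simp add: dist_norm norm_minus_commute)
  ultimately show ?thesis using that x by blast
qed

text \<open>On a small ball around the exposed point \<open>\<psi>\<close> is nearly constant, so
  undoing the tilt costs a factor \<open>exp (- n * c)\<close>. With the tilted mass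
  \<open>exp (n * (L \<psi> - g))\<close> of the ball this leaves the exponent
  \<open>- n * a\<close>: the two margins \<open>g\<close> fill the gap between \<open>a\<close> and
  the entropy.\<close>

lemma open_lower_bound:
  assumes "open U" "z \<in> U" "dual_conjugate L z < ereal a"
  shows "\<forall>\<^sub>F n in sequentially. ennreal (exp (- (real n * a))) \<le> emeasure (\<mu> n) U"
proof -
  obtain \<epsilon> where \<epsilon>: "0 < \<epsilon>" "ball z \<epsilon> \<subseteq> U" using assms(1,2) open_contains_ball by blast
  then have "0 < \<epsilon> / 2" by simp
  then obtain \<psi> x where x: "\<And>\<phi>. ((\<lambda>t. L (\<psi> + t *\<^sub>R \<phi>)) has_real_derivative blinfun_apply \<phi> x) (at 0)"
    and xz: "dist x z \<le> \<epsilon> / 2" and ent: "blinfun_apply \<psi> x - L \<psi> < a"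
    using exposed_point_near[OF assms(3)] by metis
  define g where "g = (a - (blinfun_apply \<psi> x - L \<psi>)) / 2"
  have g: "0 < g" using ent unfolding g_def by simp
  define r where "r = min (\<epsilon> / 2) (g / (1 + norm \<psi>))"
  have r: "0 < r" "r \<le> \<epsilon> / 2"
    using \<epsilon>(1) g unfolding r_def by (simp_all only: min_less_iff_conj min.cobounded1)
      (auto intro!: divide_pos_pos add_pos_nonneg)
  have "r * (1 + norm \<psi>) \<le> g"
    unfolding r_def by (metis min.cobounded2 pos_le_divide_eq add_pos_nonneg norm_ge_zero zero_less_one)
  then have r1: "norm \<psi> * r \<le> g" using r(1) by (simp add: algebra_simps)
  have ballU: "ball x r \<subseteq> U"
  proof
    fix w assume "w \<in> ball x r"
    then have "dist z w < \<epsilon>" using xz r(2) dist_triangle[of z w x] by (simp add: dist_commute)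
    then show "w \<in> U" using \<epsilon>(2) by auto
  qed
  define c where "c = blinfun_apply \<psi> x + g"
  have le_c: "blinfun_apply \<psi> w \<le> c" if "w \<in> ball x r" for w
  proof -
    have "blinfun_apply \<psi> (w - x) \<le> norm \<psi> * norm (w - x)" using norm_blinfun[of \<psi> "w - x"] by simp
    also have "\<dots> \<le> norm \<psi> * r" using that by (intro mult_left_mono) (auto simp: dist_norm norm_minus_commute)
    finally show ?thesis using r1 unfolding c_def by (simp add: blinfun.diff_right)
  qed
  show ?thesis
    using tilted_concentration[OF x r(1) g]
  proof eventually_elim
    case (elim n)
    have [measurable]: "ball x r \<in> sets (\<mu> n)" using sets_mu by simp
    have "ennreal (exp (- (real n * a))) = ennreal (exp (- (real n * c))) * ennreal (exp (real n * (L \<psi> - g)))"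
      unfolding c_def g_def by (simp add: ennreal_mult'[symmetric] exp_add[symmetric] field_simps)
    also have "\<dots> \<le> ennreal (exp (- (real n * c))) * emeasure (tilted \<psi> n) (ball x r)"
      by (intro mult_left_mono elim) simp
    also have "emeasure (tilted \<psi> n) (ball x r)
        = (\<integral>\<^sup>+w. ennreal (exp (real n * blinfun_apply \<psi> w)) * indicator (ball x r) w \<partial>\<mu> n)"
      by (intro emeasure_tilted) simp
    also have "\<dots> \<le> (\<integral>\<^sup>+w. ennreal (exp (real n * c)) * indicator (ball x r) w \<partial>\<mu> n)"
      using le_c by (intro nn_integral_mono) (auto simp: indicator_def mult_left_mono)
    also have "\<dots> = ennreal (exp (real n * c)) * emeasure (\<mu> n) (ball x r)"
      by (intro nn_integral_cmult_indicator) simp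
    also have "ennreal (exp (- (real n * c))) * \<dots> = emeasure (\<mu> n) (ball x r)"
      by (simp add: mult.assoc[symmetric] ennreal_mult'[symmetric] exp_add[symmetric])
    also have "\<dots> \<le> emeasure (\<mu> n) U"
      using ballU assms(1) sets_mu by (intro emeasure_mono) auto
    finally show ?case by (simp add: mult_left_mono)
  qed
qed

section \<open>Compactness of the level sets\<close>

lemma closed_level_set: "closed {x. dual_conjugate L x \<le> ereal c}"
proof -
  have "{x. dual_conjugate L x \<le> ereal c} = (\<Inter>\<psi>. {x. blinfun_apply \<psi> x - L \<psi> \<le> c})"
    unfolding dual_conjugate_def by (auto simp: SUP_le_iff)
  then show ?thesis by (auto intro!: closed_INT closed_Collect_le continuous_intros)
qed

text \<open>Goodness follows from the lower bound: a point of the level set outside \<open>K\<close>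
  would give \<open>- K\<close> more mass than exponential tightness allows.\<close>

lemma good_rate_conjugate: "good_rate (dual_conjugate L)"
  unfolding good_rate_def
proof (intro allI impI)
  fix c :: real
  obtain K where K: "compact K"
    "\<forall>\<^sub>F n in sequentially. emeasure (\<mu> n) (- K) \<le> ennreal (exp (- (real n * (c + 2))))"
    using exponentially_tight by blast
  have "z \<in> K" if z: "dual_conjugate L z \<le> ereal c" for z
  proof (rule ccontr)
    assume "z \<notin> K"
    have "open (- K)" using compact_imp_closed[OF K(1)] by auto
    moreover have "dual_conjugate L z < ereal (c + 1)" using z by (rule le_less_trans) simp
    ultimately have "\<forall>\<^sub>F n in sequentially. ennreal (exp (- (real n * (c + 1)))) \<le> emeasure (\<mu> n) (- K)"
      using \<open>z \<notin> K\<close> by (intro open_lower_bound) auto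
    with K(2) eventually_ge_at_top[of 1]
    have "\<forall>\<^sub>F n::nat in sequentially. False"
    proof eventually_elim
      case (elim n)
      then have "ennreal (exp (- (real n * (c + 1)))) \<le> ennreal (exp (- (real n * (c + 2))))"
        using order_trans by blast
      then have "real n * (c + 2) \<le> real n * (c + 1)" by simp
      with elim show False by simp
    qed
    then show False by simp
  qed
  then have "{x. dual_conjugate L x \<le> ereal c} = K \<inter> {x. dual_conjugate L x \<le> ereal c}" by auto
  then show "compact {x. dual_conjugate L x \<le> ereal c}"
    using compact_Int_closed[OF K(1) closed_level_set] by metis
qed

end

lemma gartner_ellis_LDP:
  fixes Z :: "nat \<Rightarrow> 'a \<Rightarrow> 'e::{banach, second_countable_topology}"
  assumes Z: "\<And>n. 1 \<le> n \<Longrightarrow> Z n \<in> borel_measurable M"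
    and GE: "gartner_ellis (\<lambda>n. distr M borel (Z n)) L" and L0: "L 0 = 0"
  shows "satisfies_LDP M Z real (dual_conjugate L)" "good_rate (dual_conjugate L)"
proof -
  interpret gartner_ellis "\<lambda>n. distr M borel (Z n)" L by fact
  have em: "emeasure (distr M borel (Z n)) A = emeasure M {\<omega> \<in> space M. Z n \<omega> \<in> A}"
    if "1 \<le> n" "A \<in> sets borel" for n A
    using Z[OF that(1)] that(2) by (subst emeasure_distr) (auto intro!: arg_cong[where f="emeasure M"])
  show "satisfies_LDP M Z real (dual_conjugate L)"
    unfolding satisfies_LDP_def
  proof (intro conjI allI impI)
    show "filterlim real at_top sequentially" by (rule filterlim_real_sequentially)
    show "0 \<le> dual_conjugate L x" for x
      unfolding dual_conjugate_def by (rule SUP_upper2[of 0]) (auto simp: L0 zero_ereal_def)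
    show "lower_semicont (dual_conjugate L)" unfolding lower_semicont_def using closed_level_set by blast
    show "- (INF x\<in>U. dual_conjugate L x) \<le> liminf (\<lambda>n. ereal (1 / real n) *
        ext_ln (emeasure M {\<omega> \<in> space M. Z n \<omega> \<in> U}))" if "open U" for U
    proof (rule liminf_scaled_ext_ln_ge)
      fix a assume "(INF x\<in>U. dual_conjugate L x) < ereal a"
      then obtain z where "z \<in> U" "dual_conjugate L z < ereal a" by (auto simp: INF_less_iff)
      from open_lower_bound[OF that this] eventually_ge_at_top[of 1]
      show "\<forall>\<^sub>F n in sequentially. ennreal (exp (- (real n * a))) \<le> emeasure M {\<omega> \<in> space M. Z n \<omega> \<in> U}"
        by eventually_elim (use that em in auto)
    qed
    show "limsup (\<lambda>n. ereal (1 / real n) * ext_ln (emeasure M {\<omega> \<in> space M. Z n \<omega> \<in> C}))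
        \<le> - (INF x\<in>C. dual_conjugate L x)" if "closed C" for C
    proof (rule limsup_scaled_ext_ln_le)
      fix a assume "ereal a < (INF x\<in>C. dual_conjugate L x)"
      from closed_upper_bound[OF that this] eventually_ge_at_top[of 1]
      show "\<forall>\<^sub>F n in sequentially. emeasure M {\<omega> \<in> space M. Z n \<omega> \<in> C} \<le> ennreal (exp (- (real n * a)))"
        by eventually_elim (use that em in auto)
    qed
  qed (use Z in auto)
  show "good_rate (dual_conjugate L)" by (rule good_rate_conjugate)
qed

section \<open>Exponential moments\<close>

lemma abs_exp_diff_le: "\<bar>exp x - 1\<bar> \<le> \<bar>x\<bar> * exp \<bar>x\<bar>" for x :: real
proof (cases "0 \<le> x")
  case True
  have "(1 - x) * exp x \<le> exp (- x) * exp x"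
    using exp_ge_add_one_self[of "- x"] by (intro mult_right_mono) auto
  then have "exp x - 1 \<le> x * exp x" by (simp add: exp_minus algebra_simps)
  with True show ?thesis by simp
next
  case False
  have "1 * \<bar>x\<bar> \<le> exp \<bar>x\<bar> * \<bar>x\<bar>" by (intro mult_right_mono) auto
  moreover have "\<bar>exp x - 1\<bar> \<le> \<bar>x\<bar>" using exp_ge_add_one_self[of x] False one_le_exp_iff[of x] by linarith
  ultimately show ?thesis by (simp add: mult.commute)
qed

lemma le_exp: "x \<le> exp x" for x :: real
  using exp_ge_add_one_self[of x] by linarith

lemma blinfun_apply_le_norm: "blinfun_apply \<theta> x \<le> norm \<theta> * norm x" for \<theta> :: "'b::real_normed_vector \<Rightarrow>\<^sub>L real"
  using norm_blinfun[of \<theta> x] by simp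

locale exponential_moments = prob_space M
  for M :: "'a measure" and Y :: "'a \<Rightarrow> 'b::{banach, second_countable_topology}" +
  assumes Y_measurable [measurable]: "Y \<in> borel_measurable M"
    and exponential_moment: "\<And>t::real. t > 0 \<Longrightarrow> integrable M (\<lambda>\<omega>. exp (t * norm (Y \<omega>)))"
begin

lemma functional_measurable [measurable]: "(\<lambda>\<omega>. blinfun_apply \<theta> (Y \<omega>)) \<in> borel_measurable M"
  for \<theta> :: "'b \<Rightarrow>\<^sub>L real"
  by (rule measurable_compose[OF Y_measurable])
    (intro borel_measurable_continuous_onI continuous_intros)

text \<open>The common route to integrability: linear factors are absorbed into a larger exponent.
  The proof passes to \<open>\<bar>c\<bar> + 1\<close> because \<open>exponential_moment\<close>
  speaks of positive exponents.\<close>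

lemma integrable_if_le_exp:
  fixes g :: "'a \<Rightarrow> 'c::{banach, second_countable_topology}"
  assumes "g \<in> borel_measurable M" "\<And>\<omega>. norm (g \<omega>) \<le> exp (c * norm (Y \<omega>))"
  shows "integrable M g"
proof (rule Bochner_Integration.integrable_bound)
  show "integrable M (\<lambda>\<omega>. exp ((\<bar>c\<bar> + 1) * norm (Y \<omega>)))" by (rule exponential_moment) simp
  show "AE \<omega> in M. norm (g \<omega>) \<le> norm (exp ((\<bar>c\<bar> + 1) * norm (Y \<omega>)))"
  proof (rule AE_I2)
    fix \<omega>
    have "exp (c * norm (Y \<omega>)) \<le> exp ((\<bar>c\<bar> + 1) * norm (Y \<omega>))"
      unfolding exp_le_cancel_iff by (intro mult_right_mono) auto
    with assms(2)[of \<omega>] show "norm (g \<omega>) \<le> norm (exp ((\<bar>c\<bar> + 1) * norm (Y \<omega>)))"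
      unfolding real_norm_def abs_exp_cancel by (rule order_trans)
  qed
qed fact

lemma integrable_exp_functional: "integrable M (\<lambda>\<omega>. exp (blinfun_apply \<theta> (Y \<omega>)))"
  for \<theta> :: "'b \<Rightarrow>\<^sub>L real"
proof (rule integrable_if_le_exp[where c="norm \<theta>"])
  show "norm (exp (blinfun_apply \<theta> (Y \<omega>))) \<le> exp (norm \<theta> * norm (Y \<omega>))" for \<omega>
    by (simp add: blinfun_apply_le_norm)
qed measurable

lemma exp_log_mgf: "exp (log_mgf M Y \<theta>) = (\<integral>\<omega>. exp (blinfun_apply \<theta> (Y \<omega>)) \<partial>M)"
proof -
  have "0 < (\<integral>\<omega>. exp (blinfun_apply \<theta> (Y \<omega>)) \<partial>M)"
    by (rule expectation_greater[OF integrable_exp_functional]) auto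
  then show ?thesis unfolding log_mgf_def by simp
qed

lemma log_mgf_0: "log_mgf M Y 0 = 0"
  unfolding log_mgf_def by (simp add: prob_space)

lemma continuous_log_mgf: "continuous_on UNIV (log_mgf M Y)"
proof -
  have "(\<lambda>k. \<integral>\<omega>. exp (blinfun_apply (\<theta> k) (Y \<omega>)) \<partial>M) \<longlonglongrightarrow> (\<integral>\<omega>. exp (blinfun_apply l (Y \<omega>)) \<partial>M)"
    if \<theta>: "\<theta> \<longlonglongrightarrow> l" for \<theta> and l :: "'b \<Rightarrow>\<^sub>L real"
  proof -
    have "Bseq \<theta>" using \<theta> by (rule convergent_imp_Bseq[OF convergentI])
    then obtain C where C: "\<And>k. norm (\<theta> k) \<le> C" by (metis BseqE)
    show ?thesis
    proof (rule integral_dominated_convergence)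
      show "integrable M (\<lambda>\<omega>. exp (C * norm (Y \<omega>)))" by (rule integrable_if_le_exp[where c=C]) auto
      show "AE \<omega> in M. (\<lambda>k. exp (blinfun_apply (\<theta> k) (Y \<omega>))) \<longlonglongrightarrow> exp (blinfun_apply l (Y \<omega>))"
        by (intro AE_I2 tendsto_intros \<theta>)
      show "AE \<omega> in M. norm (exp (blinfun_apply (\<theta> k) (Y \<omega>))) \<le> exp (C * norm (Y \<omega>))" for k
        using blinfun_apply_le_norm[of "\<theta> k"] mult_right_mono[OF C[of k] norm_ge_zero]
        by (auto intro: order_trans)
    qed auto
  qed
  then have "continuous_on UNIV (\<lambda>\<theta> :: 'b \<Rightarrow>\<^sub>L real. \<integral>\<omega>. exp (blinfun_apply \<theta> (Y \<omega>)) \<partial>M)"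
    unfolding continuous_on_sequentially by (auto simp: comp_def)
  then have "continuous_on UNIV (\<lambda>\<theta>. exp (log_mgf M Y \<theta>))" unfolding exp_log_mgf .
  from continuous_on_ln[OF this] show ?thesis by simp
qed

lemma mgf_gradient:
  "((\<lambda>t. \<integral>\<omega>. exp (blinfun_apply (\<theta> + t *\<^sub>R \<phi>) (Y \<omega>)) \<partial>M) has_real_derivative
    (\<integral>\<omega>. blinfun_apply \<phi> (Y \<omega>) * exp (blinfun_apply \<theta> (Y \<omega>)) \<partial>M)) (at 0)"
  unfolding DERIV_def
proof (subst LIMSEQ_SEQ_conv[symmetric], intro allI impI, elim conjE)
  fix S :: "nat \<Rightarrow> real" assume S0: "\<forall>n. S n \<noteq> 0" and S: "S \<longlonglongrightarrow> 0"
  have "Bseq S" using S by (rule convergent_imp_Bseq[OF convergentI])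
  then obtain C where C: "0 < C" "\<And>k. norm (S k) \<le> C" by (auto elim: BseqE)
  define q where "q k \<omega> = (exp (blinfun_apply (\<theta> + S k *\<^sub>R \<phi>) (Y \<omega>)) - exp (blinfun_apply \<theta> (Y \<omega>))) / S k" for k \<omega>
  \<comment> \<open>\<open>norm \<theta>\<close> comes from the weight,
    \<open>C * norm \<phi>\<close> from the exponential in \<open>abs_exp_diff_le\<close>, and one
    more \<open>norm \<phi>\<close> from bounding the linear factor \<open>u\<close> by
    \<open>exp u\<close>.\<close>
  define c where "c = norm \<theta> + (1 + C) * norm \<phi>"
  have q_eq: "q k \<omega> = exp (blinfun_apply \<theta> (Y \<omega>)) * ((exp (S k * blinfun_apply \<phi> (Y \<omega>)) - 1) / S k)" for k \<omega>
    unfolding q_def by (simp add: plus_blinfun.rep_eq scaleR_blinfun.rep_eq exp_add algebra_simps)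
  have "(\<lambda>k. \<integral>\<omega>. q k \<omega> \<partial>M) \<longlonglongrightarrow> (\<integral>\<omega>. blinfun_apply \<phi> (Y \<omega>) * exp (blinfun_apply \<theta> (Y \<omega>)) \<partial>M)"
  proof (rule integral_dominated_convergence)
    show "integrable M (\<lambda>\<omega>. exp (c * norm (Y \<omega>)))" by (rule integrable_if_le_exp[where c=c]) auto
    show "AE \<omega> in M. (\<lambda>k. q k \<omega>) \<longlonglongrightarrow> blinfun_apply \<phi> (Y \<omega>) * exp (blinfun_apply \<theta> (Y \<omega>))"
    proof (rule AE_I2)
      fix \<omega>
      have "((\<lambda>t. exp (t * blinfun_apply \<phi> (Y \<omega>))) has_real_derivative blinfun_apply \<phi> (Y \<omega>)) (at 0)"
        by (auto intro!: derivative_eq_intros)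
      then have "(\<lambda>t. (exp (t * blinfun_apply \<phi> (Y \<omega>)) - 1) / t) \<midarrow>0\<rightarrow> blinfun_apply \<phi> (Y \<omega>)"
        unfolding DERIV_def by simp
      then have "(\<lambda>k. (exp (S k * blinfun_apply \<phi> (Y \<omega>)) - 1) / S k) \<longlonglongrightarrow> blinfun_apply \<phi> (Y \<omega>)"
        using S0 S unfolding LIMSEQ_SEQ_conv[symmetric] by blast
      from tendsto_mult_left[OF this, of "exp (blinfun_apply \<theta> (Y \<omega>))"]
      show "(\<lambda>k. q k \<omega>) \<longlonglongrightarrow> blinfun_apply \<phi> (Y \<omega>) * exp (blinfun_apply \<theta> (Y \<omega>))"
        unfolding q_eq by (simp add: mult.commute)
    qed
    show "AE \<omega> in M. norm (q k \<omega>) \<le> exp (c * norm (Y \<omega>))" for k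
    proof (rule AE_I2)
      fix \<omega>
      define u where "u = \<bar>blinfun_apply \<phi> (Y \<omega>)\<bar>"
      have u: "0 \<le> u" "u \<le> norm \<phi> * norm (Y \<omega>)" unfolding u_def using norm_blinfun[of \<phi> "Y \<omega>"] by auto
      have "\<bar>(exp (S k * blinfun_apply \<phi> (Y \<omega>)) - 1) / S k\<bar> \<le> u * exp (\<bar>S k\<bar> * u)"
        using abs_exp_diff_le[of "S k * blinfun_apply \<phi> (Y \<omega>)"] S0
        unfolding u_def by (simp add: abs_mult field_simps)
      also have "\<dots> \<le> exp u * exp (C * u)"
        using u(1) C(2)[of k] by (intro mult_mono) (auto intro: mult_right_mono le_exp)
      also have "\<dots> = exp ((1 + C) * u)" by (simp add: exp_add[symmetric] algebra_simps)
      also have "\<dots> \<le> exp ((1 + C) * (norm \<phi> * norm (Y \<omega>)))"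
        using u(2) C(1) by (simp add: mult_left_mono)
      finally have "norm (q k \<omega>) \<le> exp (norm \<theta> * norm (Y \<omega>)) * exp ((1 + C) * (norm \<phi> * norm (Y \<omega>)))"
        unfolding q_eq norm_mult by (intro mult_mono) (auto simp: blinfun_apply_le_norm)
      then show "norm (q k \<omega>) \<le> exp (c * norm (Y \<omega>))"
        unfolding c_def by (simp add: exp_add[symmetric] algebra_simps)
    qed
  qed (unfold q_def, measurable)
  moreover have "(\<integral>\<omega>. q k \<omega> \<partial>M) = ((\<integral>\<omega>. exp (blinfun_apply (\<theta> + (0 + S k) *\<^sub>R \<phi>) (Y \<omega>)) \<partial>M) -
      (\<integral>\<omega>. exp (blinfun_apply (\<theta> + 0 *\<^sub>R \<phi>) (Y \<omega>)) \<partial>M)) / S k" for k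
    unfolding q_def using integrable_exp_functional by simp
  ultimately show "(\<lambda>k. ((\<integral>\<omega>. exp (blinfun_apply (\<theta> + (0 + S k) *\<^sub>R \<phi>) (Y \<omega>)) \<partial>M) -
      (\<integral>\<omega>. exp (blinfun_apply (\<theta> + 0 *\<^sub>R \<phi>) (Y \<omega>)) \<partial>M)) / S k)
    \<longlonglongrightarrow> (\<integral>\<omega>. blinfun_apply \<phi> (Y \<omega>) * exp (blinfun_apply \<theta> (Y \<omega>)) \<partial>M)"
    by simp
qed

text \<open>The gradient \<open>v /\<^sub>R m\<close> is the mean of \<open>Y\<close> under the law
  tilted by \<open>\<theta>\<close>. A Bochner integral commutes with bounded functionals, so one
  vector serves all directions.\<close>

lemma log_mgf_gradient:
  obtains x where "\<And>\<phi>. ((\<lambda>t. log_mgf M Y (\<theta> + t *\<^sub>R \<phi>)) has_real_derivative blinfun_apply \<phi> x) (at 0)"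
proof -
  define m where "m = (\<integral>\<omega>. exp (blinfun_apply \<theta> (Y \<omega>)) \<partial>M)"
  have m: "0 < m" unfolding m_def exp_log_mgf[symmetric] by simp
  define v where "v = (\<integral>\<omega>. exp (blinfun_apply \<theta> (Y \<omega>)) *\<^sub>R Y \<omega> \<partial>M)"
  have int: "integrable M (\<lambda>\<omega>. exp (blinfun_apply \<theta> (Y \<omega>)) *\<^sub>R Y \<omega>)"
  proof (rule integrable_if_le_exp[where c="norm \<theta> + 1"])
    fix \<omega>
    have "exp (blinfun_apply \<theta> (Y \<omega>)) * norm (Y \<omega>) \<le> exp (norm \<theta> * norm (Y \<omega>)) * exp (norm (Y \<omega>))"
      by (intro mult_mono) (auto simp: blinfun_apply_le_norm le_exp)
    then show "norm (exp (blinfun_apply \<theta> (Y \<omega>)) *\<^sub>R Y \<omega>) \<le> exp ((norm \<theta> + 1) * norm (Y \<omega>))"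
      by (simp add: exp_add[symmetric] algebra_simps)
  qed measurable
  have "((\<lambda>t. log_mgf M Y (\<theta> + t *\<^sub>R \<phi>)) has_real_derivative blinfun_apply \<phi> (v /\<^sub>R m)) (at 0)" for \<phi>
  proof -
    have "(\<integral>\<omega>. blinfun_apply \<phi> (Y \<omega>) * exp (blinfun_apply \<theta> (Y \<omega>)) \<partial>M) = blinfun_apply \<phi> v"
      unfolding v_def using integral_bounded_linear[OF blinfun.bounded_linear_right int, of \<phi>]
      by (simp add: blinfun.scaleR_right mult.commute)
    with mgf_gradient[of \<theta> \<phi>] m
    show ?thesis unfolding log_mgf_def
      by (auto intro!: derivative_eq_intros simp: m_def blinfun.scaleR_right divide_inverse)
  qed
  then show ?thesis using that by blast
qed

text \<open>Dominated convergence brings the exponential moment of the error down to 1, so any bound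
  above 1 can be reached. The value \<open>exp 1\<close> is taken because a product over
  \<open>N n\<close> terms then costs \<open>exp (N n)\<close>, whose moment is governed by
  \<open>LN 1\<close>.\<close>

lemma simple_approximation:
  assumes "0 \<le> t"
  obtains f :: "'b \<Rightarrow> 'b" where "simple_function borel f"
    "(\<integral>\<^sup>+\<omega>. ennreal (exp (t * norm (Y \<omega> - f (Y \<omega>)))) \<partial>M) \<le> ennreal (exp 1)"
proof -
  obtain F :: "nat \<Rightarrow> 'b \<Rightarrow> 'b" where F: "\<And>i. simple_function borel (F i)"
    "\<And>x. (\<lambda>i. F i x) \<longlonglongrightarrow> x" "\<And>i x. dist (F i x) 0 \<le> 2 * dist x 0"
    using borel_measurable_implies_sequence_metric[of "\<lambda>x::'b. x" borel 0] by auto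
  have [measurable]: "F i \<in> borel_measurable borel" for i
    using F(1) by (rule borel_measurable_simple_function)
  have bound: "exp (t * norm (Y \<omega> - F i (Y \<omega>))) \<le> exp ((t * 3) * norm (Y \<omega>))" for i \<omega>
  proof -
    have "norm (Y \<omega> - F i (Y \<omega>)) \<le> 3 * norm (Y \<omega>)"
      using norm_triangle_ineq4[of "Y \<omega>" "F i (Y \<omega>)"] F(3)[of i "Y \<omega>"] by simp
    from mult_left_mono[OF this assms] show ?thesis by simp
  qed
  have "(\<lambda>i. \<integral>\<omega>. exp (t * norm (Y \<omega> - F i (Y \<omega>))) \<partial>M) \<longlonglongrightarrow> (\<integral>\<omega>. 1 \<partial>M)"
  proof (rule integral_dominated_convergence)
    show "integrable M (\<lambda>\<omega>. exp ((t * 3) * norm (Y \<omega>)))" by (rule integrable_if_le_exp[where c="t * 3"]) auto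
    show "AE \<omega> in M. norm (exp (t * norm (Y \<omega> - F i (Y \<omega>)))) \<le> exp ((t * 3) * norm (Y \<omega>))" for i
      using bound by simp
    show "AE \<omega> in M. (\<lambda>i. exp (t * norm (Y \<omega> - F i (Y \<omega>)))) \<longlonglongrightarrow> 1"
    proof (rule AE_I2)
      fix \<omega>
      have "(\<lambda>i. exp (t * norm (Y \<omega> - F i (Y \<omega>)))) \<longlonglongrightarrow> exp (t * norm (Y \<omega> - Y \<omega>))"
        by (intro tendsto_intros F(2))
      then show "(\<lambda>i. exp (t * norm (Y \<omega> - F i (Y \<omega>)))) \<longlonglongrightarrow> 1" by simp
    qed
  qed measurable
  then have "(\<lambda>i. \<integral>\<omega>. exp (t * norm (Y \<omega> - F i (Y \<omega>))) \<partial>M) \<longlonglongrightarrow> 1" by (simp add: prob_space)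
  moreover have "1 < exp (1::real)" by simp
  ultimately have "\<forall>\<^sub>F i in sequentially. (\<integral>\<omega>. exp (t * norm (Y \<omega> - F i (Y \<omega>))) \<partial>M) < exp 1"
    by (rule order_tendstoD)
  then obtain i where i: "(\<integral>\<omega>. exp (t * norm (Y \<omega> - F i (Y \<omega>))) \<partial>M) < exp 1"
    by (auto simp: eventually_sequentially)
  have "integrable M (\<lambda>\<omega>. exp (t * norm (Y \<omega> - F i (Y \<omega>))))"
    using bound by (intro integrable_if_le_exp[where c="t * 3"]) auto
  then have "(\<integral>\<^sup>+\<omega>. ennreal (exp (t * norm (Y \<omega> - F i (Y \<omega>)))) \<partial>M)
      = ennreal (\<integral>\<omega>. exp (t * norm (Y \<omega> - F i (Y \<omega>))) \<partial>M)"
    by (rule nn_integral_eq_integral) simp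
  with i have "(\<integral>\<^sup>+\<omega>. ennreal (exp (t * norm (Y \<omega> - F i (Y \<omega>)))) \<partial>M) \<le> ennreal (exp 1)"
    by (simp add: ennreal_leI)
  with F(1) that show ?thesis by blast
qed

end

text \<open>A finite net of one \<open>K j\<close> with \<open>\<delta> j < \<epsilon> / 2\<close>
  is a net of the whole intersection. Nonemptiness matters: \<open>infdist x {} = 0\<close> would
  impose no condition for a nonnegative radius.\<close>

lemma compact_INT_infdist:
  fixes K :: "nat \<Rightarrow> 'b::{complete_space} set"
  assumes K: "\<And>j. compact (K j)" "\<And>j. K j \<noteq> {}" and \<delta>: "\<delta> \<longlonglongrightarrow> (0::real)"
  shows "compact (\<Inter>j. {x. infdist x (K j) \<le> \<delta> j})"
proof (rule compact_eq_totally_bounded[THEN iffD2], intro conjI allI impI)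
  have "closed (\<Inter>j. {x. infdist x (K j) \<le> \<delta> j})"
    by (intro closed_INT ballI closed_Collect_le continuous_intros)
  then show "uniform_space_class.complete (\<Inter>j. {x. infdist x (K j) \<le> \<delta> j})" by (simp add: complete_eq_closed)
  fix \<epsilon> :: real assume \<epsilon>: "0 < \<epsilon>"
  then obtain j where j: "\<delta> j < \<epsilon> / 2"
    using order_tendstoD(2)[OF \<delta>, of "\<epsilon> / 2"] by (auto simp: eventually_sequentially)
  obtain k where k: "finite k" "K j \<subseteq> (\<Union>x\<in>k. ball x (\<epsilon> / 2))"
    using K(1)[of j] \<epsilon> unfolding compact_eq_totally_bounded by (meson half_gt_zero)
  have "(\<Inter>j. {x. infdist x (K j) \<le> \<delta> j}) \<subseteq> (\<Union>x\<in>k. ball x \<epsilon>)"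
  proof
    fix x assume "x \<in> (\<Inter>j. {x. infdist x (K j) \<le> \<delta> j})"
    then have "infdist x (K j) \<le> \<delta> j" by blast
    then have "infdist x (K j) < \<epsilon> / 2" using j by (rule le_less_trans)
    then have "Inf (dist x ` K j) < \<epsilon> / 2" using K(2)[of j] by (simp add: infdist_notempty)
    then have "\<exists>d\<in>dist x ` K j. d < \<epsilon> / 2" using K(2)[of j] by (intro cInf_lessD) auto
    then obtain y where y: "y \<in> K j" "dist x y < \<epsilon> / 2" by blast
    with k(2) obtain z where z: "z \<in> k" "dist z y < \<epsilon> / 2" by auto
    have "dist z x < \<epsilon>" using dist_triangle2[of z x y] y(2) z(2) by linarith
    with z(1) show "x \<in> (\<Union>x\<in>k. ball x \<epsilon>)" by auto
  qed
  with k(1) show "\<exists>k. finite k \<and> (\<Inter>j. {x. infdist x (K j) \<le> \<delta> j}) \<subseteq> (\<Union>x\<in>k. ball x \<epsilon>)" by blast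
qed

section \<open>Sums with a random number of terms\<close>

lemma (in prob_space) indep_var_nn_integral:
  fixes f g :: "'a \<Rightarrow> ennreal"
  assumes "indep_var borel f borel g"
  shows "(\<integral>\<^sup>+\<omega>. f \<omega> * g \<omega> \<partial>M) = (\<integral>\<^sup>+\<omega>. f \<omega> \<partial>M) * (\<integral>\<^sup>+\<omega>. g \<omega> \<partial>M)"
proof -
  have "indep_vars (\<lambda>_. borel) (case_bool f g) UNIV"
    using assms unfolding indep_var_def by (simp add: case_bool_if if_distrib cong: if_cong)
  from indep_vars_nn_integral[OF _ this] show ?thesis by (simp add: UNIV_bool mult.commute)
qed

locale compound_sums = prob_space M
  for M :: "'a measure" +
  fixes X :: "nat \<Rightarrow> 'a \<Rightarrow> 'b::{banach, second_countable_topology}"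
    and N :: "nat \<Rightarrow> 'a \<Rightarrow> nat"
    and LN :: "real \<Rightarrow> real"
  assumes indep_X: "indep_vars (\<lambda>_. borel) X {1..}"
    and distr_X: "\<And>n. n \<ge> 1 \<Longrightarrow> distr M borel (X n) = distr M borel (X 1)"
    and moments: "\<And>t::real. t > 0 \<Longrightarrow> integrable M (\<lambda>\<omega>. exp (t * norm (X 1 \<omega>)))"
    and N_measurable: "\<And>n. n \<ge> 1 \<Longrightarrow> N n \<in> measurable M (count_space UNIV)"
    and indep_N_X: "indep_set
           (sigma_sets (space M) {N n -` A \<inter> space M | n A. n \<ge> 1})
           (sigma_sets (space M) {X n -` A \<inter> space M | n A. n \<ge> 1 \<and> A \<in> sets borel})"
    and lim_N: "\<And>\<eta>::real. (\<lambda>n. ereal (1 / real n) *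
           ext_ln (\<integral>\<^sup>+\<omega>. ennreal (exp (\<eta> * real (N n \<omega>))) \<partial>M)) \<longlonglongrightarrow> ereal (LN \<eta>)"
    and diff_N: "LN differentiable_on UNIV"
begin

definition S :: "nat \<Rightarrow> 'a \<Rightarrow> 'b" where "S k \<omega> = (\<Sum>i=1..k. X i \<omega>)"

definition Z :: "nat \<Rightarrow> 'a \<Rightarrow> 'b \<times> real" where
  "Z n \<omega> = (S (N n \<omega>) \<omega> /\<^sub>R real n, real (N n \<omega>) / real n)"

abbreviation LX :: "('b \<Rightarrow>\<^sub>L real) \<Rightarrow> real" where "LX \<equiv> log_mgf M (X 1)"

lemma X_measurable [measurable]: "1 \<le> n \<Longrightarrow> X n \<in> borel_measurable M"
  using indep_X unfolding indep_vars_def by auto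

sublocale X1: exponential_moments M "X 1"
  by unfold_locales (rule X_measurable[OF order_refl], rule moments)

lemma Z_measurable:
  assumes n: "1 \<le> n"
  shows "Z n \<in> borel_measurable M"
proof -
  note [measurable] = N_measurable[OF n]
  have [measurable]: "S k \<in> borel_measurable M" for k
    unfolding S_def by (intro borel_measurable_sum X_measurable) auto
  have "(\<lambda>\<omega>. S (N n \<omega>) \<omega>) \<in> borel_measurable M"
    by (rule measurable_compose_countable) measurable
  then show ?thesis unfolding Z_def by measurable
qed

text \<open>Conditioning on \<open>N n\<close> without conditional expectations: on
  \<open>A k\<close> the product has \<open>k\<close> factors and is independent of
  \<open>A k\<close>. A general \<open>h\<close> serves both the moment generating function and the
  approximation errors.\<close>

lemma nn_integral_compound_prod:
  fixes h :: "'b \<Rightarrow> ennreal"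
  assumes n: "1 \<le> n" and h [measurable]: "h \<in> borel_measurable borel"
  shows "(\<integral>\<^sup>+\<omega>. (\<Prod>i=1..N n \<omega>. h (X i \<omega>)) \<partial>M) = (\<integral>\<^sup>+\<omega>. (\<integral>\<^sup>+\<omega>'. h (X 1 \<omega>') \<partial>M) ^ N n \<omega> \<partial>M)"
proof -
  note [measurable] = N_measurable[OF n]
  define A where "A k = N n -` {k} \<inter> space M" for k
  define m where "m = (\<integral>\<^sup>+\<omega>. h (X 1 \<omega>) \<partial>M)"
  define g where "g k \<omega> = (\<Prod>i=1..k. h (X i \<omega>))" for k \<omega>
  have A_sets [measurable]: "A k \<in> sets M" for k unfolding A_def by measurable
  have A_disj: "disjoint_family A" unfolding disjoint_family_on_def A_def by auto
  have g_meas [measurable]: "g k \<in> borel_measurable M" for k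
    unfolding g_def by (intro borel_measurable_prod_ennreal measurable_compose[OF X_measurable h]) auto
  let ?GX = "{X n -` A \<inter> space M | n A. n \<ge> 1 \<and> A \<in> sets borel}"
  let ?GN = "{N n -` A \<inter> space M | n A. n \<ge> 1}"
  have "(\<integral>\<^sup>+\<omega>. h (X i \<omega>) \<partial>M) = m" if "1 \<le> i" for i
  proof -
    have "(\<integral>\<^sup>+\<omega>. h (X i \<omega>) \<partial>M) = (\<integral>\<^sup>+x. h x \<partial>distr M borel (X i))"
      using that by (subst nn_integral_distr) auto
    also have "\<dots> = m" unfolding distr_X[OF that] m_def by (subst nn_integral_distr) auto
    finally show ?thesis .
  qed
  moreover have "indep_vars (\<lambda>_. borel) (\<lambda>i \<omega>. h (X i \<omega>)) {1..k}" for k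
    by (rule indep_vars_compose2[OF indep_vars_subset[OF indep_X]]) auto
  ultimately have int_g: "(\<integral>\<^sup>+\<omega>. g k \<omega> \<partial>M) = m ^ k" for k
    unfolding g_def by (subst indep_vars_nn_integral) auto
  have "(\<integral>\<^sup>+\<omega>. g k \<omega> * indicator (A k) \<omega> \<partial>M) = m ^ k * emeasure M (A k)" for k
  proof -
    have "indep_var borel (indicator (A k)) borel (g k)"
      unfolding indep_var_eq
    proof (intro conjI)
      have gen_X: "?GX \<subseteq> Pow (space M)" by auto
      \<comment> \<open>Measurability for the generated sigma-algebra, and not just for
        \<open>M\<close>, is what carries the hypothesis \<open>indep_N_X\<close> over to
        \<open>g k\<close>.\<close>
      have "X i \<in> measurable (sigma (space M) ?GX) borel" if "1 \<le> i" for i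
      proof (rule measurableI)
        fix A :: "'b set" assume "A \<in> sets borel"
        with that have "X i -` A \<inter> space M \<in> ?GX" by blast
        then show "X i -` A \<inter> space (sigma (space M) ?GX) \<in> sets (sigma (space M) ?GX)"
          unfolding space_measure_of[OF gen_X] sets_measure_of[OF gen_X] by (rule sigma_sets.Basic)
      qed simp
      then have "g k \<in> measurable (sigma (space M) ?GX) borel"
        unfolding g_def by (intro borel_measurable_prod_ennreal measurable_compose[OF _ h]) auto
      then have "g k -` B \<inter> space M \<in> sigma_sets (space M) ?GX" if "B \<in> sets borel" for B
        using measurable_sets[of "g k" "sigma (space M) ?GX" borel B] that
        unfolding space_measure_of[OF gen_X] sets_measure_of[OF gen_X] by blast
      then have X_sub: "sigma_sets (space M) {g k -` B \<inter> space M |B. B \<in> sets borel}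
          \<subseteq> sigma_sets (space M) ?GX"
        by (intro sigma_sets_mono) blast
      have "indicator (A k) -` B \<inter> space M \<in> sigma_sets (space M) ?GN" for B :: "ennreal set"
      proof -
        have ind: "indicator (A k) \<omega> = (indicator {k} (N n \<omega>) :: ennreal)" if "\<omega> \<in> space M" for \<omega>
          unfolding A_def using that by (simp add: indicator_def)
        have "indicator (A k) -` B \<inter> space M = N n -` {j. indicator {k} j \<in> B} \<inter> space M"
        proof (rule set_eqI)
          fix \<omega>
          show "\<omega> \<in> indicator (A k) -` B \<inter> space M \<longleftrightarrow> \<omega> \<in> N n -` {j. indicator {k} j \<in> B} \<inter> space M"
            by (cases "\<omega> \<in> space M") (simp_all add: ind)
        qed
        with n have "indicator (A k) -` B \<inter> space M \<in> ?GN" by blast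
        then show ?thesis by (rule sigma_sets.Basic)
      qed
      then have N_sub: "sigma_sets (space M) {indicator (A k) -` B \<inter> space M |B. B \<in> sets (borel :: ennreal measure)}
          \<subseteq> sigma_sets (space M) ?GN"
        by (intro sigma_sets_mono) blast
      from indep_N_X
      show "indep_set (sigma_sets (space M) {indicator (A k) -` B \<inter> space M |B. B \<in> sets (borel :: ennreal measure)})
          (sigma_sets (space M) {g k -` B \<inter> space M |B. B \<in> sets borel})"
        unfolding indep_set_def
      proof (rule indep_sets_mono_sets)
        fix b
        show "case_bool (sigma_sets (space M) {indicator (A k) -` B \<inter> space M |B. B \<in> sets (borel :: ennreal measure)})
            (sigma_sets (space M) {g k -` B \<inter> space M |B. B \<in> sets borel}) b
          \<subseteq> case_bool (sigma_sets (space M) ?GN) (sigma_sets (space M) ?GX) b"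
          using N_sub X_sub by (cases b) (simp_all only: bool.case)
      qed
    qed measurable
    from indep_var_nn_integral[OF this] show ?thesis
      by (simp add: int_g mult.commute)
  qed
  moreover have "(\<integral>\<^sup>+\<omega>. m ^ k * indicator (A k) \<omega> \<partial>M) = m ^ k * emeasure M (A k)" for k
    by (intro nn_integral_cmult_indicator) measurable
  ultimately have eq: "(\<integral>\<^sup>+\<omega>. g k \<omega> * indicator (A k) \<omega> \<partial>M) = (\<integral>\<^sup>+\<omega>. m ^ k * indicator (A k) \<omega> \<partial>M)" for k
    by simp
  have "(\<integral>\<^sup>+\<omega>. g (N n \<omega>) \<omega> \<partial>M) = (\<integral>\<^sup>+\<omega>. (\<Sum>k. g k \<omega> * indicator (A k) \<omega>) \<partial>M)"
  proof (intro nn_integral_cong)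
    fix \<omega> assume "\<omega> \<in> space M"
    then have "\<omega> \<in> A (N n \<omega>)" unfolding A_def by simp
    from suminf_cmult_indicator[OF A_disj this, of "\<lambda>k. g k \<omega>"]
    show "g (N n \<omega>) \<omega> = (\<Sum>k. g k \<omega> * indicator (A k) \<omega>)" by simp
  qed
  also have "\<dots> = (\<Sum>k. \<integral>\<^sup>+\<omega>. g k \<omega> * indicator (A k) \<omega> \<partial>M)" by (intro nn_integral_suminf) measurable
  also have "\<dots> = (\<Sum>k. \<integral>\<^sup>+\<omega>. m ^ k * indicator (A k) \<omega> \<partial>M)" unfolding eq ..
  also have "\<dots> = (\<integral>\<^sup>+\<omega>. (\<Sum>k. m ^ k * indicator (A k) \<omega>) \<partial>M)" by (intro nn_integral_suminf[symmetric]) measurable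
  also have "\<dots> = (\<integral>\<^sup>+\<omega>. m ^ N n \<omega> \<partial>M)"
  proof (intro nn_integral_cong)
    fix \<omega> assume "\<omega> \<in> space M"
    then have "\<omega> \<in> A (N n \<omega>)" unfolding A_def by simp
    from suminf_cmult_indicator[OF A_disj this, of "\<lambda>k. m ^ k"]
    show "(\<Sum>k. m ^ k * indicator (A k) \<omega>) = m ^ N n \<omega>" by simp
  qed
  finally show ?thesis unfolding g_def m_def .
qed

section \<open>The dual of the product space as pairs \<open>(\<theta>, \<eta>)\<close>\<close>

definition fst_functional :: "(('b \<times> real) \<Rightarrow>\<^sub>L real) \<Rightarrow> ('b \<Rightarrow>\<^sub>L real)" where
  "fst_functional \<psi> = Blinfun (\<lambda>x. blinfun_apply \<psi> (x, 0))"

lemma fst_functional_apply [simp]: "blinfun_apply (fst_functional \<psi>) x = blinfun_apply \<psi> (x, 0)"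
proof -
  have "bounded_linear (\<lambda>x. blinfun_apply \<psi> (x, 0))"
    by (intro bounded_linear_compose[OF blinfun.bounded_linear_right]
        bounded_linear_Pair bounded_linear_ident bounded_linear_zero)
  then show ?thesis unfolding fst_functional_def by (simp add: bounded_linear_Blinfun_apply)
qed

lemma functional_split: "blinfun_apply \<psi> (x, y) = blinfun_apply \<psi> (x, 0) + y * blinfun_apply \<psi> (0, 1)"
  for \<psi> :: "('b \<times> real) \<Rightarrow>\<^sub>L real"
proof -
  have "(x, y) = (x, 0) + y *\<^sub>R (0, 1)" by simp
  then show ?thesis by (simp only: blinfun.add_right blinfun.scaleR_right) simp
qed

lemma fst_functional_linear:
  "fst_functional (\<psi> + t *\<^sub>R \<phi>) = fst_functional \<psi> + t *\<^sub>R fst_functional \<phi>"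
  by (rule blinfun_eqI) (simp add: plus_blinfun.rep_eq scaleR_blinfun.rep_eq)

lemma continuous_fst_functional: "continuous_on UNIV fst_functional"
proof -
  have "bounded_linear fst_functional"
  proof (rule bounded_linear_intro[where K=1])
    show "fst_functional (\<psi> + \<phi>) = fst_functional \<psi> + fst_functional \<phi>" for \<psi> \<phi>
      using fst_functional_linear[of \<psi> 1 \<phi>] by simp
    show "fst_functional (t *\<^sub>R \<psi>) = t *\<^sub>R fst_functional \<psi>" for t \<psi>
      by (rule blinfun_eqI) (simp add: scaleR_blinfun.rep_eq)
    show "norm (fst_functional \<psi>) \<le> norm \<psi> * 1" for \<psi>
    proof (rule norm_blinfun_bound)
      show "norm (blinfun_apply (fst_functional \<psi>) x) \<le> norm \<psi> * 1 * norm x" for x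
        using norm_blinfun[of \<psi> "(x, 0)"] by (simp add: norm_Pair)
    qed simp
  qed
  then show ?thesis by (rule linear_continuous_on)
qed

definition L :: "(('b \<times> real) \<Rightarrow>\<^sub>L real) \<Rightarrow> real" where
  "L \<psi> = LN (blinfun_apply \<psi> (0, 1) + LX (fst_functional \<psi>))"

text \<open>The scaling by \<open>n\<close> cancels, and each of the \<open>N n\<close> terms
  contributes one factor \<open>h (X i)\<close>, to which the second coordinate adds
  \<open>exp \<eta>\<close>. The identity is exact for each \<open>n\<close>, so no limit beyond
  that for \<open>N n\<close> has to be taken.\<close>

lemma compound_mgf:
  assumes n: "1 \<le> n"
  shows "(\<integral>\<^sup>+z. ennreal (exp (real n * blinfun_apply \<psi> z)) \<partial>distr M borel (Z n))
    = (\<integral>\<^sup>+\<omega>. ennreal (exp ((blinfun_apply \<psi> (0, 1) + LX (fst_functional \<psi>)) * real (N n \<omega>))) \<partial>M)"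
proof -
  let ?\<theta> = "fst_functional \<psi>" and ?\<eta> = "blinfun_apply \<psi> (0, 1)"
  define h where "h x = ennreal (exp (blinfun_apply ?\<theta> x + ?\<eta>))" for x
  have [measurable]: "blinfun_apply \<phi> \<in> borel_measurable borel" for \<phi> :: "'c::real_normed_vector \<Rightarrow>\<^sub>L real"
    by (intro borel_measurable_continuous_onI continuous_intros)
  have [measurable]: "h \<in> borel_measurable borel" unfolding h_def by measurable
  have prod: "ennreal (exp (real n * blinfun_apply \<psi> (Z n \<omega>))) = (\<Prod>i=1..N n \<omega>. h (X i \<omega>))" for \<omega>
  proof -
    have "real n * blinfun_apply \<psi> (Z n \<omega>) = blinfun_apply \<psi> (real n *\<^sub>R Z n \<omega>)"
      by (simp add: blinfun.scaleR_right)
    also have "real n *\<^sub>R Z n \<omega> = (S (N n \<omega>) \<omega>, real (N n \<omega>))" using n unfolding Z_def by simp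
    also have "blinfun_apply \<psi> \<dots> = blinfun_apply ?\<theta> (S (N n \<omega>) \<omega>) + real (N n \<omega>) * ?\<eta>"
      by (subst functional_split) simp
    also have "\<dots> = (\<Sum>i=1..N n \<omega>. blinfun_apply ?\<theta> (X i \<omega>) + ?\<eta>)"
      unfolding S_def by (simp only: blinfun.sum_right sum.distrib) simp
    finally show ?thesis unfolding h_def by (simp only: exp_sum[OF finite_atLeastAtMost] prod_ennreal exp_ge_zero)
  qed
  have one: "(\<integral>\<^sup>+\<omega>. h (X 1 \<omega>) \<partial>M) = ennreal (exp (?\<eta> + LX ?\<theta>))"
  proof -
    have "(\<integral>\<^sup>+\<omega>. h (X 1 \<omega>) \<partial>M) = (\<integral>\<^sup>+\<omega>. ennreal (exp (blinfun_apply ?\<theta> (X 1 \<omega>)) * exp ?\<eta>) \<partial>M)"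
      unfolding h_def exp_add ..
    also have "\<dots> = ennreal (\<integral>\<omega>. exp (blinfun_apply ?\<theta> (X 1 \<omega>)) * exp ?\<eta> \<partial>M)"
      by (intro nn_integral_eq_integral integrable_mult_left X1.integrable_exp_functional) auto
    also have "(\<integral>\<omega>. exp (blinfun_apply ?\<theta> (X 1 \<omega>)) * exp ?\<eta> \<partial>M) = exp (?\<eta> + LX ?\<theta>)"
      unfolding exp_add X1.exp_log_mgf by (simp add: mult.commute)
    finally show ?thesis .
  qed
  have "(\<integral>\<^sup>+z. ennreal (exp (real n * blinfun_apply \<psi> z)) \<partial>distr M borel (Z n))
      = (\<integral>\<^sup>+\<omega>. ennreal (exp (real n * blinfun_apply \<psi> (Z n \<omega>))) \<partial>M)"
    by (intro nn_integral_distr Z_measurable n) measurable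
  also have "\<dots> = (\<integral>\<^sup>+\<omega>. (\<Prod>i=1..N n \<omega>. h (X i \<omega>)) \<partial>M)" unfolding prod ..
  also have "\<dots> = (\<integral>\<^sup>+\<omega>. ennreal (exp (?\<eta> + LX ?\<theta>)) ^ N n \<omega> \<partial>M)"
    unfolding one[symmetric] by (rule nn_integral_compound_prod[OF n]) measurable
  finally show ?thesis
    by (simp add: ennreal_power exp_of_nat_mult[symmetric] mult.commute)
qed

lemma LN_0: "LN 0 = 0"
proof -
  have "(\<lambda>n. ereal (1 / real n) * ext_ln 1) \<longlonglongrightarrow> ereal (LN 0)"
    using lim_N[of 0] by (simp add: emeasure_space_1)
  moreover have "ext_ln 1 = 0" by (simp add: ext_ln_def zero_ereal_def)
  ultimately have "(\<lambda>n. 0) \<longlonglongrightarrow> ereal (LN 0)" by simp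
  then have "0 = ereal (LN 0)" by (rule LIMSEQ_unique[OF tendsto_const])
  then show ?thesis by simp
qed

section \<open>Tails of the number of terms and of the approximation errors\<close>

lemma nn_integral_exp_N:
  "\<forall>\<^sub>F n in sequentially. (\<integral>\<^sup>+\<omega>. ennreal (exp (real (N n \<omega>))) \<partial>M) \<le> ennreal (exp (real n * (LN 1 + 1)))"
  using scaled_ext_ln_tendstoD(1)[OF lim_N[of 1], of 1] by simp

lemma N_tail:
  assumes n: "1 \<le> n"
    and bound: "(\<integral>\<^sup>+\<omega>. ennreal (exp (real (N n \<omega>))) \<partial>M) \<le> ennreal (exp (real n * b))"
  shows "emeasure M {\<omega>\<in>space M. c * real n < real (N n \<omega>)} \<le> ennreal (exp (- (real n * (c - b))))"
proof -
  note [measurable] = N_measurable[OF n]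
  have "emeasure M {\<omega>\<in>space M. c * real n < real (N n \<omega>)}
      = (\<integral>\<^sup>+\<omega>. indicator {\<omega>\<in>space M. c * real n < real (N n \<omega>)} \<omega> \<partial>M)" by simp
  also have "\<dots> \<le> (\<integral>\<^sup>+\<omega>. ennreal (exp (- (c * real n))) * ennreal (exp (real (N n \<omega>))) \<partial>M)"
    by (intro nn_integral_mono) (auto simp: indicator_def ennreal_mult'[symmetric] exp_add[symmetric])
  also have "\<dots> = ennreal (exp (- (c * real n))) * (\<integral>\<^sup>+\<omega>. ennreal (exp (real (N n \<omega>))) \<partial>M)"
    by (intro nn_integral_cmult) measurable
  also have "\<dots> \<le> ennreal (exp (- (c * real n))) * ennreal (exp (real n * b))"
    by (intro mult_left_mono bound) simp
  finally show ?thesis by (simp add: ennreal_mult'[symmetric] exp_add[symmetric] algebra_simps)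
qed

text \<open>Each error has exponential moment at most \<open>exp 1\<close> whatever \<open>t\<close>
  is, so the product costs no more than the moment of \<open>exp (N n)\<close>. Thus
  \<open>b\<close> does not depend on \<open>t\<close>, and the rate \<open>t * \<delta> - b\<close>
  grows beyond all bounds with \<open>t\<close>.\<close>

lemma approximation_tail:
  fixes f :: "'b \<Rightarrow> 'b"
  assumes n: "1 \<le> n" and t: "0 < t" and f: "simple_function borel f"
    and f_moment: "(\<integral>\<^sup>+\<omega>. ennreal (exp (t * norm (X 1 \<omega> - f (X 1 \<omega>)))) \<partial>M) \<le> ennreal (exp 1)"
    and bound: "(\<integral>\<^sup>+\<omega>. ennreal (exp (real (N n \<omega>))) \<partial>M) \<le> ennreal (exp (real n * b))"
  shows "emeasure M {\<omega>\<in>space M. \<delta> * real n < (\<Sum>i=1..N n \<omega>. norm (X i \<omega> - f (X i \<omega>)))}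
    \<le> ennreal (exp (- (real n * (t * \<delta> - b))))"
proof -
  note [measurable] = N_measurable[OF n]
  have [measurable]: "f \<in> borel_measurable borel" using f by (rule borel_measurable_simple_function)
  define h where "h x = ennreal (exp (t * norm (x - f x)))" for x
  have h_meas [measurable]: "h \<in> borel_measurable borel" unfolding h_def by measurable
  have [measurable]: "(\<lambda>\<omega>. \<Sum>i=1..k. norm (X i \<omega> - f (X i \<omega>))) \<in> borel_measurable M" for k
    by (intro borel_measurable_sum) measurable
  have [measurable]: "(\<lambda>\<omega>. \<Sum>i=1..N n \<omega>. norm (X i \<omega> - f (X i \<omega>))) \<in> borel_measurable M"
    by (rule measurable_compose_countable) measurable
  have [measurable]: "(\<lambda>\<omega>. \<Prod>i=1..k. h (X i \<omega>)) \<in> borel_measurable M" for k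
    by (intro borel_measurable_prod_ennreal) measurable
  have [measurable]: "(\<lambda>\<omega>. \<Prod>i=1..N n \<omega>. h (X i \<omega>)) \<in> borel_measurable M"
    by (rule measurable_compose_countable) measurable
  have "(\<integral>\<^sup>+\<omega>. (\<Prod>i=1..N n \<omega>. h (X i \<omega>)) \<partial>M) = (\<integral>\<^sup>+\<omega>. (\<integral>\<^sup>+\<omega>'. h (X 1 \<omega>') \<partial>M) ^ N n \<omega> \<partial>M)"
    by (rule nn_integral_compound_prod[OF n h_meas])
  also have "\<dots> \<le> (\<integral>\<^sup>+\<omega>. ennreal (exp (real (N n \<omega>))) \<partial>M)"
  proof (intro nn_integral_mono)
    fix \<omega>
    have "(\<integral>\<^sup>+\<omega>'. h (X 1 \<omega>') \<partial>M) ^ N n \<omega> \<le> ennreal (exp 1) ^ N n \<omega>"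
      unfolding h_def by (intro power_mono f_moment) simp
    then show "(\<integral>\<^sup>+\<omega>'. h (X 1 \<omega>') \<partial>M) ^ N n \<omega> \<le> ennreal (exp (real (N n \<omega>)))"
      by (simp add: ennreal_power exp_of_nat_mult[symmetric])
  qed
  also have "\<dots> \<le> ennreal (exp (real n * b))" by (rule bound)
  finally have prod_le: "(\<integral>\<^sup>+\<omega>. (\<Prod>i=1..N n \<omega>. h (X i \<omega>)) \<partial>M) \<le> ennreal (exp (real n * b))" .
  let ?A = "{\<omega>\<in>space M. \<delta> * real n < (\<Sum>i=1..N n \<omega>. norm (X i \<omega> - f (X i \<omega>)))}"
  have "emeasure M ?A = (\<integral>\<^sup>+\<omega>. indicator ?A \<omega> \<partial>M)" by simp
  also have "\<dots> \<le> (\<integral>\<^sup>+\<omega>. ennreal (exp (- (t * \<delta> * real n))) * (\<Prod>i=1..N n \<omega>. h (X i \<omega>)) \<partial>M)"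
  proof (intro nn_integral_mono)
    fix \<omega>
    define s where "s = (\<Sum>i=1..N n \<omega>. norm (X i \<omega> - f (X i \<omega>)))"
    have "(\<Prod>i=1..N n \<omega>. h (X i \<omega>)) = ennreal (exp (t * s))"
      unfolding h_def s_def by (simp add: prod_ennreal exp_sum sum_distrib_left)
    then have "ennreal (exp (- (t * \<delta> * real n))) * (\<Prod>i=1..N n \<omega>. h (X i \<omega>)) = ennreal (exp (t * (s - \<delta> * real n)))"
      by (simp add: ennreal_mult'[symmetric] exp_add[symmetric] algebra_simps)
    moreover have "1 \<le> exp (t * (s - \<delta> * real n))" if "\<delta> * real n < s"
      using that t mult_nonneg_nonneg[of t "s - \<delta> * real n"] by simp
    ultimately show "indicator ?A \<omega> \<le> ennreal (exp (- (t * \<delta> * real n))) * (\<Prod>i=1..N n \<omega>. h (X i \<omega>))"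
      unfolding s_def[symmetric] by (simp add: indicator_def s_def[symmetric] del: One_nat_def)
  qed
  also have "\<dots> = ennreal (exp (- (t * \<delta> * real n))) * (\<integral>\<^sup>+\<omega>. (\<Prod>i=1..N n \<omega>. h (X i \<omega>)) \<partial>M)"
    by (intro nn_integral_cmult) measurable
  also have "\<dots> \<le> ennreal (exp (- (t * \<delta> * real n))) * ennreal (exp (real n * b))"
    by (intro mult_left_mono prod_le) simp
  finally show ?thesis
    by (simp add: ennreal_mult'[symmetric] exp_add[symmetric] algebra_simps)
qed

end

section \<open>Exponential tightness and the rate function\<close>

lemma ext_ln_mono:
  assumes "p \<le> q"
  shows "ext_ln p \<le> ext_ln q"
proof (cases q)
  case (real s)
  with assms obtain r where r: "p = ennreal r" "0 \<le> r" by (cases p) (auto simp: top_unique)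
  with real assms show ?thesis by (auto simp: ext_ln_def)
qed (simp add: ext_ln_def)

text \<open>\<open>Lim\<close> is a definite description, so convergence has to be proved before
  \<open>limit_at_minus_infinity\<close> can be evaluated.\<close>

lemma Lim_at_bot_mono:
  fixes f :: "real \<Rightarrow> ereal"
  assumes "mono f"
  shows "Lim at_bot f = (INF x. f x)"
proof (rule tendsto_Lim[OF trivial_limit_at_bot_linorder], rule order_tendstoI)
  fix a assume "a < (INF x. f x)"
  then show "\<forall>\<^sub>F x in at_bot. a < f x" by (intro always_eventually allI) (erule less_le_trans, simp add: INF_lower)
next
  fix a assume "(INF x. f x) < a"
  then obtain x where "f x < a" by (auto simp: INF_less_iff)
  then have "f z < a" if "z \<le> x" for z using monoD[OF assms that] by simp
  then show "\<forall>\<^sub>F x in at_bot. f x < a" unfolding eventually_at_bot_linorder by blast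
qed

text \<open>The sum is the scalar \<open>s * real k\<close> times an average, which lies in a hull
  independent of \<open>k\<close>. Inserting 0 covers \<open>k = 0\<close>, where the average is an
  empty sum.\<close>

lemma scaled_sum_in_compact:
  fixes v :: "nat \<Rightarrow> 'b::real_normed_vector"
  assumes "\<And>i. v i \<in> D" "0 \<le> s" "s * real k \<le> c"
  shows "s *\<^sub>R (\<Sum>i=1..k. v i) \<in> (\<lambda>(u, x). u *\<^sub>R x) ` ({0..c} \<times> (convex hull (insert 0 D)))"
proof -
  have "(\<Sum>i=1..k. (1 / real k) *\<^sub>R v i) \<in> convex hull (insert 0 D)"
  proof (cases "k = 0")
    case True
    then show ?thesis by (simp add: hull_inc)
  next
    case False
    then show ?thesis
      by (intro convex_sum convex_convex_hull) (auto intro!: hull_inc assms(1))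
  qed
  moreover have "s *\<^sub>R (\<Sum>i=1..k. v i) = (s * real k) *\<^sub>R (\<Sum>i=1..k. (1 / real k) *\<^sub>R v i)"
    by (cases "k = 0") (simp_all add: scaleR_sum_right[symmetric])
  moreover have "s * real k \<in> {0..c}" using assms by simp
  ultimately show ?thesis by (intro image_eqI[of _ _ "(s * real k, \<Sum>i=1..k. (1 / real k) *\<^sub>R v i)"]) auto
qed

lemma compact_scaled_hull:
  fixes D :: "'b::real_normed_vector set"
  assumes "finite D"
  shows "compact ((\<lambda>(u, x). u *\<^sub>R x) ` ({0..c::real} \<times> (convex hull (insert 0 D))))"
proof (rule compact_continuous_image)
  show "continuous_on ({0..c} \<times> (convex hull (insert 0 D))) (\<lambda>(u, x). u *\<^sub>R x)"
    unfolding case_prod_unfold by (intro continuous_intros)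
  show "compact ({0..c} \<times> (convex hull (insert 0 D)))"
    using assms by (intro compact_Times finite_imp_compact_convex_hull) auto
qed

context compound_sums
begin

text \<open>Up to an event of small probability, the sums of \<open>X i\<close> are \<open>\<delta> j\<close>-close to sums of the
  finitely-valued \<open>f j (X i)\<close>, whose averages lie in a fixed compact set; intersecting the
  neighbourhoods of these sets over \<open>j\<close> gives a compact set.\<close>

lemma Z_exponentially_tight:
  "\<exists>K. compact K \<and>
    (\<forall>\<^sub>F n in sequentially. emeasure (distr M borel (Z n)) (- K) \<le> ennreal (exp (- (real n * a))))"
proof -
  define b where "b = LN 1 + 1"
  \<comment> \<open>The slack 2 in \<open>a + 2 \<le> c - b\<close>: one unit leaves room for adding
    the tails of \<open>N n\<close> and of the errors, the other supplies the \<open>Suc\<close> in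
    the geometric weights of the events \<open>E j\<close>.\<close>
  define c where "c = \<bar>a\<bar> + \<bar>LN 1\<bar> + 3"
  have c: "0 < c" "a + 2 \<le> c - b" unfolding c_def b_def by auto
  define \<delta> where "\<delta> j = 1 / (1 + real j)" for j
  have \<delta>_pos: "0 < \<delta> j" for j unfolding \<delta>_def by simp
  have \<delta>_lim: "\<delta> \<longlonglongrightarrow> 0"
    unfolding \<delta>_def by real_asymp
  \<comment> \<open>Raising the order of the moment with \<open>j\<close> makes the rate of
    \<open>E j\<close> grow linearly in \<open>j\<close>, so that infinitely many events have
    summable probabilities.\<close>
  define t where "t j = (c + real j) / \<delta> j" for j
  have t: "0 < t j" "t j * \<delta> j = c + real j" for j
    using \<delta>_pos[of j] c(1) unfolding t_def by (auto intro!: divide_pos_pos add_pos_nonneg)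
  have "\<exists>f. simple_function borel f \<and>
      (\<integral>\<^sup>+\<omega>. ennreal (exp (t j * norm (X 1 \<omega> - f (X 1 \<omega>)))) \<partial>M) \<le> ennreal (exp 1)" for j
    using X1.simple_approximation[of "t j"] t(1)[of j] less_imp_le by metis
  then obtain f where f: "\<And>j. simple_function borel (f j)"
    "\<And>j. (\<integral>\<^sup>+\<omega>. ennreal (exp (t j * norm (X 1 \<omega> - f j (X 1 \<omega>)))) \<partial>M) \<le> ennreal (exp 1)"
    by metis
  have [measurable]: "f j \<in> borel_measurable borel" for j
    using f(1) by (rule borel_measurable_simple_function)
  define C where "C j = (\<lambda>(u, x). u *\<^sub>R x) ` ({0..c} \<times> (convex hull (insert 0 (range (f j)))))" for j
  have "finite (range (f j))" for j using simple_functionD(1)[OF f(1), of j] by simp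
  then have C_compact: "compact (C j)" for j unfolding C_def by (rule compact_scaled_hull)
  have C_ne: "C j \<noteq> {}" for j
    using scaled_sum_in_compact[of "\<lambda>_. f j 0" "range (f j)" 0 0 c] c(1) unfolding C_def by auto
  define K where "K = (\<Inter>j. {x. infdist x (C j) \<le> \<delta> j}) \<times> {0..c}"
  have K_compact: "compact K"
    unfolding K_def by (intro compact_Times compact_INT_infdist C_compact C_ne \<delta>_lim) simp
  have lt: "a < a + 1" "a < c - b" using c(2) by auto
  have "\<forall>\<^sub>F n in sequentially. emeasure (distr M borel (Z n)) (- K) \<le> ennreal (exp (- (real n * a)))"
    using nn_integral_exp_N[folded b_def] eventually_ge_at_top[of 1] eventually_exp_add_le[OF lt]
  proof eventually_elim
    case (elim n)
    note n = elim(2)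
    have n_pos: "0 < real n" using n by simp
    note [measurable] = N_measurable[OF n]
    define A where "A = {\<omega>\<in>space M. c * real n < real (N n \<omega>)}"
    define E where "E j = {\<omega>\<in>space M. \<delta> j * real n < (\<Sum>i=1..N n \<omega>. norm (X i \<omega> - f j (X i \<omega>)))}" for j
    have [measurable]: "(\<lambda>\<omega>. \<Sum>i=1..k. norm (X i \<omega> - f j (X i \<omega>))) \<in> borel_measurable M" for j k
      by (intro borel_measurable_sum) measurable
    have [measurable]: "(\<lambda>\<omega>. \<Sum>i=1..N n \<omega>. norm (X i \<omega> - f j (X i \<omega>))) \<in> borel_measurable M" for j
      by (rule measurable_compose_countable) measurable
    have A_sets: "A \<in> sets M" unfolding A_def by measurable
    have E_sets: "E j \<in> sets M" for j unfolding E_def by measurable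
    have Z_in_K: "Z n \<omega> \<in> K" if "\<omega> \<in> space M" "\<omega> \<notin> A" "\<And>j. \<omega> \<notin> E j" for \<omega>
    proof -
      have N_le: "real (N n \<omega>) \<le> c * real n" using that unfolding A_def by simp
      have "infdist (S (N n \<omega>) \<omega> /\<^sub>R real n) (C j) \<le> \<delta> j" for j
      proof -
        let ?y = "inverse (real n) *\<^sub>R (\<Sum>i=1..N n \<omega>. f j (X i \<omega>))"
        have "?y \<in> C j"
          unfolding C_def using N_le n_pos by (intro scaled_sum_in_compact) (auto simp: field_simps)
        then have "infdist (S (N n \<omega>) \<omega> /\<^sub>R real n) (C j) \<le> dist (S (N n \<omega>) \<omega> /\<^sub>R real n) ?y"
          by (rule infdist_le)
        also have "\<dots> = norm (\<Sum>i=1..N n \<omega>. X i \<omega> - f j (X i \<omega>)) / real n"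
          unfolding dist_norm S_def scaleR_diff_right[symmetric] sum_subtractf[symmetric]
          using n_pos by (simp add: divide_inverse mult.commute)
        also have "\<dots> \<le> (\<Sum>i=1..N n \<omega>. norm (X i \<omega> - f j (X i \<omega>))) / real n"
          by (intro divide_right_mono norm_sum) simp
        also have "\<dots> \<le> \<delta> j"
          using that(1) that(3)[of j] n_pos unfolding E_def by (simp add: divide_le_eq)
        finally show ?thesis .
      qed
      then show ?thesis using N_le n_pos unfolding K_def Z_def by (simp add: divide_le_eq)
    qed
    have E_bound: "emeasure M (E j) \<le> ennreal (exp (- (real n * (a + 1)))) * ennreal ((1/2) ^ Suc j)" for j
    proof -
      have "emeasure M (E j) \<le> ennreal (exp (- (real n * (t j * \<delta> j - b))))"
        unfolding E_def by (rule approximation_tail[OF n t(1) f elim(1)])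
      also have "\<dots> \<le> ennreal (exp (- (real n * (a + 1))) * (1/2) ^ Suc j)"
      proof (rule ennreal_leI)
        \<comment> \<open>Because \<open>n \<ge> 1\<close>, the surplus \<open>Suc j\<close> can be
          freed from the factor \<open>n\<close>; the resulting weights \<open>(1/2) ^ Suc j\<close>
          sum to 1 for every \<open>n\<close>.\<close>
        have "real n * (a + 1) + real (Suc j) \<le> real n * (a + 1) + real n * real (Suc j)"
          using n by simp
        also have "\<dots> \<le> real n * (t j * \<delta> j - b)"
          unfolding t(2) distrib_left[symmetric] using c(2) by (intro mult_left_mono) auto
        finally have "exp (- (real n * (t j * \<delta> j - b))) \<le> exp (- (real n * (a + 1))) * exp (- real (Suc j))"
          by (simp add: exp_add[symmetric])
        also have "exp (- real (Suc j)) = exp (- 1) ^ Suc j"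
          by (simp only: exp_of_nat_mult[symmetric]) simp
        also have "\<dots> \<le> (1/2) ^ Suc j"
          using exp_ge_add_one_self[of 1] by (intro power_mono) (auto simp: exp_minus field_simps)
        finally show "exp (- (real n * (t j * \<delta> j - b))) \<le> exp (- (real n * (a + 1))) * (1/2) ^ Suc j"
          by (simp add: mult_left_mono)
      qed
      finally show ?thesis unfolding ennreal_mult'[OF exp_ge_zero] .
    qed
    have "- K \<in> sets borel" using compact_imp_closed[OF K_compact] by auto
    then have "emeasure (distr M borel (Z n)) (- K) = emeasure M (Z n -` (- K) \<inter> space M)"
      by (rule emeasure_distr[OF Z_measurable[OF n]])
    also have "\<dots> \<le> emeasure M ((\<Union>j. E j) \<union> A)"
    proof (rule emeasure_mono)
      show "Z n -` (- K) \<inter> space M \<subseteq> (\<Union>j. E j) \<union> A" using Z_in_K by blast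
    qed (use A_sets E_sets in auto)
    also have "\<dots> \<le> emeasure M (\<Union>j. E j) + emeasure M A"
      using A_sets E_sets by (intro emeasure_subadditive) auto
    also have "\<dots> \<le> (\<Sum>j. emeasure M (E j)) + emeasure M A"
      using E_sets by (intro add_right_mono emeasure_subadditive_countably) auto
    also have "\<dots> \<le> (\<Sum>j. ennreal (exp (- (real n * (a + 1)))) * ennreal ((1/2) ^ Suc j)) +
        ennreal (exp (- (real n * (c - b))))"
      using N_tail[OF n elim(1), of c] unfolding A_def by (intro add_mono suminf_le E_bound) auto
    also have "(\<Sum>j. ennreal (exp (- (real n * (a + 1)))) * ennreal ((1/2) ^ Suc j)) = ennreal (exp (- (real n * (a + 1))))"
      unfolding ennreal_suminf_cmult
      by (subst suminf_ennreal_eq[OF _ power_half_series]) auto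
    also have "\<dots> + ennreal (exp (- (real n * (c - b)))) \<le> ennreal (exp (- (real n * a)))"
      by (rule elim(3))
    finally show ?case by simp
  qed
  with K_compact show ?thesis by blast
qed

section \<open>Gradient of the limit and the hypotheses of the Gaertner-Ellis theorem\<close>

lemma LN_derivative: "(LN has_real_derivative deriv LN u) (at u)"
  using diff_N by (simp add: differentiable_on_def DERIV_deriv_iff_real_differentiable)

text \<open>By the chain rule the gradient is \<open>(x, 1)\<close> scaled by the derivative of
  \<open>LN\<close>, with \<open>x\<close> the gradient of \<open>LX\<close>; it is again a vector
  of the space.\<close>

lemma L_gradient: "\<exists>x. \<forall>\<phi>. ((\<lambda>t. L (\<psi> + t *\<^sub>R \<phi>)) has_real_derivative blinfun_apply \<phi> x) (at 0)"
proof -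
  obtain x where x: "\<And>\<phi>. ((\<lambda>t. LX (fst_functional \<psi> + t *\<^sub>R \<phi>)) has_real_derivative blinfun_apply \<phi> x) (at 0)"
    using X1.log_mgf_gradient[of "fst_functional \<psi>"] by blast
  define u where "u = blinfun_apply \<psi> (0, 1) + LX (fst_functional \<psi>)"
  have "((\<lambda>t. L (\<psi> + t *\<^sub>R \<phi>)) has_real_derivative blinfun_apply \<phi> (deriv LN u *\<^sub>R (x, 1))) (at 0)" for \<phi>
  proof -
    let ?g = "\<lambda>t. (blinfun_apply \<psi> (0, 1) + t * blinfun_apply \<phi> (0, 1)) +
      LX (fst_functional \<psi> + t *\<^sub>R fst_functional \<phi>)"
    have "(?g has_real_derivative blinfun_apply \<phi> (0, 1) + blinfun_apply \<phi> (x, 0)) (at 0)"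
      by (rule derivative_eq_intros x refl | simp)+
    then have "((\<lambda>t. LN (?g t)) has_real_derivative
        deriv LN u * (blinfun_apply \<phi> (0, 1) + blinfun_apply \<phi> (x, 0))) (at 0)"
      by (rule DERIV_chain2[rotated]) (use LN_derivative[of u] in \<open>simp add: u_def\<close>)
    moreover have "L (\<psi> + t *\<^sub>R \<phi>) = LN (?g t)" for t
      unfolding L_def fst_functional_linear by (simp add: plus_blinfun.rep_eq scaleR_blinfun.rep_eq)
    moreover have "blinfun_apply \<phi> (deriv LN u *\<^sub>R (x, 1))
        = deriv LN u * (blinfun_apply \<phi> (0, 1) + blinfun_apply \<phi> (x, 0))"
      by (simp only: blinfun.scaleR_right functional_split[of \<phi> x 1]) simp
    ultimately show ?thesis by simp
  qed
  then show ?thesis by blast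
qed

lemma gartner_ellis_Z: "gartner_ellis (\<lambda>n. distr M borel (Z n)) L"
proof
  show "\<forall>\<^sub>F n in sequentially. (\<integral>\<^sup>+z. ennreal (exp (real n * blinfun_apply \<psi> z)) \<partial>distr M borel (Z n))
      \<le> ennreal (exp (real n * (L \<psi> + \<epsilon>)))" if "0 < \<epsilon>" for \<psi> \<epsilon>
    using scaled_ext_ln_tendstoD(1)[OF lim_N that] eventually_ge_at_top[of 1]
    by eventually_elim (simp add: compound_mgf L_def)
  show "\<forall>\<^sub>F n in sequentially. ennreal (exp (real n * (L \<psi> - \<epsilon>)))
      \<le> (\<integral>\<^sup>+z. ennreal (exp (real n * blinfun_apply \<psi> z)) \<partial>distr M borel (Z n))" if "0 < \<epsilon>" for \<psi> \<epsilon>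
    using scaled_ext_ln_tendstoD(2)[OF lim_N that] eventually_ge_at_top[of 1]
    by eventually_elim (simp add: compound_mgf L_def)
  have LX_cont: "continuous_on UNIV (\<lambda>\<psi>. LX (fst_functional \<psi>))"
    by (rule continuous_on_compose2[OF X1.continuous_log_mgf continuous_fst_functional]) simp
  show "continuous_on UNIV L"
    unfolding L_def
    by (rule continuous_on_compose2[OF differentiable_imp_continuous_on[OF diff_N]])
      (intro continuous_intros LX_cont, simp)
qed (use Z_exponentially_tight L_gradient in auto)

section \<open>Evaluation of the rate function\<close>

lemma log_mgf_X_0 [simp]: "log_mgf M (X (Suc 0)) 0 = 0"
  using X1.log_mgf_0 by simp

lemma L_0: "L 0 = 0"
proof -
  have "fst_functional 0 = 0" by (rule blinfun_eqI) simp
  then show ?thesis unfolding L_def by (simp add: LN_0)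
qed

lemma rate_SN_eq_dual_conjugate: "rate_SN LX LN = dual_conjugate L"
proof
  fix z :: "'b \<times> real"
  obtain x y where z: "z = (x, y)" by (cases z)
  have "(SUP (\<theta>, \<eta>)\<in>UNIV. ereal (blinfun_apply \<theta> x + \<eta> * y - LN (\<eta> + LX \<theta>)))
      = (SUP \<psi>. ereal (blinfun_apply \<psi> (x, y) - L \<psi>))" (is "?l = ?r")
  proof (rule antisym)
    show "?l \<le> ?r"
    proof (rule SUP_least, unfold split_paired_all prod.case)
      fix \<theta> :: "'b \<Rightarrow>\<^sub>L real" and \<eta> :: real
      define \<psi> where "\<psi> = Blinfun (\<lambda>z::'b \<times> real. blinfun_apply \<theta> (fst z) + \<eta> * snd z)"
      have "bounded_linear (\<lambda>z::'b \<times> real. blinfun_apply \<theta> (fst z) + \<eta> * snd z)"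
        by (intro bounded_linear_add bounded_linear_compose[OF blinfun.bounded_linear_right]
            bounded_linear_fst bounded_linear_const_mult bounded_linear_snd)
      then have \<psi>: "blinfun_apply \<psi> w = blinfun_apply \<theta> (fst w) + \<eta> * snd w" for w
        unfolding \<psi>_def by (simp add: bounded_linear_Blinfun_apply)
      have "fst_functional \<psi> = \<theta>" by (rule blinfun_eqI) (simp add: \<psi>)
      then have "blinfun_apply \<theta> x + \<eta> * y - LN (\<eta> + LX \<theta>) = blinfun_apply \<psi> (x, y) - L \<psi>"
        unfolding L_def by (simp add: \<psi>)
      then show "ereal (blinfun_apply \<theta> x + \<eta> * y - LN (\<eta> + LX \<theta>)) \<le> ?r"
        by (simp only:) (rule SUP_upper, rule UNIV_I)
    qed
    show "?r \<le> ?l"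
    proof (rule SUP_least)
      fix \<psi>
      show "ereal (blinfun_apply \<psi> (x, y) - L \<psi>) \<le> ?l"
        by (rule SUP_upper2[of "(fst_functional \<psi>, blinfun_apply \<psi> (0, 1))"])
          (simp_all add: L_def functional_split[of \<psi> x y] mult.commute)
    qed
  qed
  then show "rate_SN LX LN z = dual_conjugate L z"
    unfolding rate_SN_def dual_conjugate_def z by simp
qed

lemma mono_LN: "mono LN"
proof (rule monoI)
  fix \<eta> \<zeta> :: real assume le: "\<eta> \<le> \<zeta>"
  have "\<forall>\<^sub>F n in sequentially. ereal (1 / real n) * ext_ln (\<integral>\<^sup>+\<omega>. ennreal (exp (\<eta> * real (N n \<omega>))) \<partial>M)
      \<le> ereal (1 / real n) * ext_ln (\<integral>\<^sup>+\<omega>. ennreal (exp (\<zeta> * real (N n \<omega>))) \<partial>M)"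
  proof (rule always_eventually, rule allI)
    fix n
    have "(\<integral>\<^sup>+\<omega>. ennreal (exp (\<eta> * real (N n \<omega>))) \<partial>M) \<le> (\<integral>\<^sup>+\<omega>. ennreal (exp (\<zeta> * real (N n \<omega>))) \<partial>M)"
      using le by (intro nn_integral_mono ennreal_leI) (simp add: mult_right_mono)
    then have "ext_ln (\<integral>\<^sup>+\<omega>. ennreal (exp (\<eta> * real (N n \<omega>))) \<partial>M)
        \<le> ext_ln (\<integral>\<^sup>+\<omega>. ennreal (exp (\<zeta> * real (N n \<omega>))) \<partial>M)"
      by (rule ext_ln_mono)
    then show "ereal (1 / real n) * ext_ln (\<integral>\<^sup>+\<omega>. ennreal (exp (\<eta> * real (N n \<omega>))) \<partial>M)
      \<le> ereal (1 / real n) * ext_ln (\<integral>\<^sup>+\<omega>. ennreal (exp (\<zeta> * real (N n \<omega>))) \<partial>M)"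
      by (intro ereal_mult_left_mono) auto
  qed
  from tendsto_le[OF sequentially_bot lim_N lim_N this] show "LN \<eta> \<le> LN \<zeta>" by simp
qed

text \<open>The substitution \<open>\<zeta> = \<eta> + LX \<theta>\<close> decouples the variables:
  the objective becomes a term in \<open>\<theta>\<close> alone plus
  \<open>\<zeta> * y - LN \<zeta>\<close>, and the supremum over two independent variables is the
  sum of the suprema.\<close>

lemma rate_SN_pos:
  assumes y: "0 < y"
  shows "rate_SN LX LN (x, y) = ereal y * dual_conjugate LX (x /\<^sub>R y) + real_conjugate LN y"
proof (rule antisym)
  define W where "W = (SUP \<theta>. ereal (blinfun_apply \<theta> x - y * LX \<theta>))"
  have scale: "ereal y * ereal (blinfun_apply \<theta> (x /\<^sub>R y) - LX \<theta>) = ereal (blinfun_apply \<theta> x - y * LX \<theta>)" for \<theta>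
    using y by (simp add: blinfun.scaleR_right algebra_simps)
  show "rate_SN LX LN (x, y) \<le> ereal y * dual_conjugate LX (x /\<^sub>R y) + real_conjugate LN y"
    unfolding rate_SN_def
    prod.case
  proof (rule SUP_least, unfold split_paired_all prod.case)
    fix \<theta> :: "'b \<Rightarrow>\<^sub>L real" and \<eta> :: real
    have "ereal (blinfun_apply \<theta> x + \<eta> * y - LN (\<eta> + LX \<theta>))
        = ereal y * ereal (blinfun_apply \<theta> (x /\<^sub>R y) - LX \<theta>) + ereal ((\<eta> + LX \<theta>) * y - LN (\<eta> + LX \<theta>))"
      unfolding scale by (simp add: algebra_simps)
    also have "\<dots> \<le> ereal y * dual_conjugate LX (x /\<^sub>R y) + real_conjugate LN y"
      unfolding dual_conjugate_def real_conjugate_def using y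
      by (intro add_mono ereal_mult_left_mono SUP_upper) auto
    finally show "ereal (blinfun_apply \<theta> x + \<eta> * y - LN (\<eta> + LX \<theta>))
        \<le> ereal y * dual_conjugate LX (x /\<^sub>R y) + real_conjugate LN y" .
  qed
  have "dual_conjugate LX (x /\<^sub>R y) \<le> W / ereal y"
    unfolding dual_conjugate_def
  proof (rule SUP_least)
    fix \<theta>
    have "ereal y * ereal (blinfun_apply \<theta> (x /\<^sub>R y) - LX \<theta>) \<le> W"
      unfolding scale W_def by (rule SUP_upper) simp
    then show "ereal (blinfun_apply \<theta> (x /\<^sub>R y) - LX \<theta>) \<le> W / ereal y"
      using y by (simp add: ereal_le_divide_pos del: times_ereal.simps)
  qed
  then have "ereal y * dual_conjugate LX (x /\<^sub>R y) \<le> W"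
    using y by (simp add: ereal_le_divide_pos)
  then have "ereal y * dual_conjugate LX (x /\<^sub>R y) + real_conjugate LN y \<le> W + real_conjugate LN y"
    by (rule add_right_mono)
  also have "\<dots> = (SUP \<zeta>. W + ereal (\<zeta> * y - LN \<zeta>))"
  proof -
    \<comment> \<open>Moving the sum inside the supremum in \<open>ereal\<close> asks for this;
      \<open>W\<close> is a supremum of real numbers over a nonempty set.\<close>
    have "W \<noteq> -\<infinity>"
      unfolding W_def by (auto simp: Sup_eq_MInfty)
    then show ?thesis unfolding real_conjugate_def by (intro SUP_ereal_add_right[symmetric]) auto
  qed
  also have "\<dots> \<le> rate_SN LX LN (x, y)"
  proof (rule SUP_least)
    fix \<zeta> :: real
    have "W + ereal (\<zeta> * y - LN \<zeta>) = (SUP \<theta>. ereal (blinfun_apply \<theta> x - y * LX \<theta>) + ereal (\<zeta> * y - LN \<zeta>))"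
      unfolding W_def by (intro SUP_ereal_add_left[symmetric]) auto
    also have "\<dots> \<le> rate_SN LX LN (x, y)"
    proof (rule SUP_least)
      fix \<theta>
      show "ereal (blinfun_apply \<theta> x - y * LX \<theta>) + ereal (\<zeta> * y - LN \<zeta>) \<le> rate_SN LX LN (x, y)"
        unfolding rate_SN_def prod.case
        by (rule SUP_upper2[of "(\<theta>, \<zeta> - LX \<theta>)"]) (auto simp: algebra_simps)
    qed
    finally show "W + ereal (\<zeta> * y - LN \<zeta>) \<le> rate_SN LX LN (x, y)" .
  qed
  finally show "ereal y * dual_conjugate LX (x /\<^sub>R y) + real_conjugate LN y \<le> rate_SN LX LN (x, y)" .
qed

text \<open>At the origin the objective is \<open>- LN (\<eta> + LX \<theta>)\<close>, whose
  argument covers all reals already for \<open>\<theta> = 0\<close>; monotonicity turns the infimum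
  of \<open>LN\<close> into its limit.\<close>

lemma rate_SN_zero: "rate_SN LX LN (0, 0) = - limit_at_minus_infinity LN"
proof -
  have "limit_at_minus_infinity LN = (INF \<eta>. ereal (LN \<eta>))"
    unfolding limit_at_minus_infinity_def
    by (rule Lim_at_bot_mono) (use mono_LN in \<open>auto simp: mono_def\<close>)
  then have "- limit_at_minus_infinity LN = (SUP \<eta>. - ereal (LN \<eta>))"
    by (simp only: ereal_SUP_uminus_eq)
  also have "\<dots> = rate_SN LX LN (0, 0)"
    unfolding rate_SN_def prod.case
  proof (rule antisym)
    show "(SUP \<eta>. - ereal (LN \<eta>)) \<le> (SUP (\<theta>, \<eta>)\<in>UNIV. ereal (blinfun_apply \<theta> 0 + \<eta> * 0 - LN (\<eta> + LX \<theta>)))"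
    proof (rule SUP_least)
      fix \<eta> :: real
      show "- ereal (LN \<eta>) \<le> (SUP (\<theta>, \<eta>)\<in>UNIV. ereal (blinfun_apply \<theta> 0 + \<eta> * 0 - LN (\<eta> + LX \<theta>)))"
        by (rule SUP_upper2[of "(0, \<eta>)"]) auto
    qed
    show "(SUP (\<theta>, \<eta>)\<in>UNIV. ereal (blinfun_apply \<theta> 0 + \<eta> * 0 - LN (\<eta> + LX \<theta>))) \<le> (SUP \<eta>. - ereal (LN \<eta>))"
    proof (rule SUP_least, unfold split_paired_all prod.case)
      fix \<theta> :: "'b \<Rightarrow>\<^sub>L real" and \<eta> :: real
      show "ereal (blinfun_apply \<theta> 0 + \<eta> * 0 - LN (\<eta> + LX \<theta>)) \<le> (SUP \<eta>. - ereal (LN \<eta>))"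
        by (rule SUP_upper2[of "\<eta> + LX \<theta>"]) auto
    qed
  qed
  finally show ?thesis by simp
qed

text \<open>For \<open>y = 0\<close> a multiple of a norming functional makes the linear term as
  large as wished, and \<open>\<eta> = - LX \<theta>'\<close> removes the penalty because
  \<open>LN 0 = 0\<close>. For \<open>y < 0\<close> take \<open>\<theta> = 0\<close> and
  \<open>\<eta> = real n / y\<close>, where \<open>LN\<close> is nonpositive.\<close>

lemma rate_SN_infinite:
  assumes "\<not> 0 < y" "(x, y) \<noteq> (0, 0)"
  shows "rate_SN LX LN (x, y) = \<infinity>"
  unfolding rate_SN_def prod.case
proof (rule SUP_PInfty)
  fix n :: nat
  show "\<exists>p\<in>UNIV. ereal (real n) \<le> (case p of (\<theta>, \<eta>) \<Rightarrow> ereal (blinfun_apply \<theta> x + \<eta> * y - LN (\<eta> + LX \<theta>)))"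
  proof (cases "y = 0")
    case True
    then have "x \<noteq> 0" using assms(2) by simp
    obtain \<theta> :: "'b \<Rightarrow>\<^sub>L real" where \<theta>: "blinfun_apply \<theta> x = norm x"
      using Hahn_Banach_norming[of x] by metis
    define \<theta>' where "\<theta>' = (real n / norm x) *\<^sub>R \<theta>"
    have "blinfun_apply \<theta>' x = real n" using \<theta> \<open>x \<noteq> 0\<close> unfolding \<theta>'_def by (simp add: scaleR_blinfun.rep_eq)
    then show ?thesis using True by (intro bexI[of _ "(\<theta>', - LX \<theta>')"]) (auto simp: LN_0)
  next
    case False
    then have y: "y < 0" using assms(1) by simp
    then have "real n / y \<le> 0" by (simp add: divide_nonneg_neg)
    then have "LN (real n / y) \<le> 0" using monoD[OF mono_LN, of "real n / y" 0] by (simp add: LN_0)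
    then show ?thesis using y by (intro bexI[of _ "(0, real n / y)"]) auto
  qed
qed

end

theorem proposition3p1:
  fixes M :: "'a measure"
    and X :: "nat \<Rightarrow> 'a \<Rightarrow> 'b::{banach, second_countable_topology}"
    and N :: "nat \<Rightarrow> 'a \<Rightarrow> nat"
    and \<Lambda>\<^sub>N :: "real \<Rightarrow> real"
  assumes "prob_space M"
    and "prob_space.indep_vars M (\<lambda>_. borel) X {1..}"
    and "\<And>n. n \<ge> 1 \<Longrightarrow> distr M borel (X n) = distr M borel (X 1)"
    and "\<And>t::real. t > 0 \<Longrightarrow> integrable M (\<lambda>\<omega>. exp (t * norm (X 1 \<omega>)))"
    and "\<And>n. n \<ge> 1 \<Longrightarrow> N n \<in> measurable M (count_space UNIV)"
    and "prob_space.indep_set M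
           (sigma_sets (space M) {N n -` A \<inter> space M | n A. n \<ge> 1})
           (sigma_sets (space M) {X n -` A \<inter> space M | n A. n \<ge> 1 \<and> A \<in> sets borel})"
    and "\<And>\<eta>::real. (\<lambda>n. ereal (1 / real n) * ext_ln (\<integral>\<^sup>+\<omega>. ennreal (exp (\<eta> * real (N n \<omega>))) \<partial>M))
           \<longlonglongrightarrow> ereal (\<Lambda>\<^sub>N \<eta>)"
    and "\<Lambda>\<^sub>N differentiable_on UNIV"
  defines "S \<equiv> (\<lambda>k \<omega>. \<Sum>i=1..k. X i \<omega>)"
    and "\<Lambda>\<^sub>X \<equiv> log_mgf M (X 1)"
  shows "satisfies_LDP M
           (\<lambda>n \<omega>. (S (N n \<omega>) \<omega> /\<^sub>R real n, real (N n \<omega>) / real n))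
           (\<lambda>n. real n) (rate_SN \<Lambda>\<^sub>X \<Lambda>\<^sub>N)
       \<and> good_rate (rate_SN \<Lambda>\<^sub>X \<Lambda>\<^sub>N)
       \<and> (\<forall>x y. rate_SN \<Lambda>\<^sub>X \<Lambda>\<^sub>N (x, y) =
             (if y > 0 then ereal y * dual_conjugate \<Lambda>\<^sub>X (x /\<^sub>R y) + real_conjugate \<Lambda>\<^sub>N y
              else if (x, y) = (0, 0) then - limit_at_minus_infinity \<Lambda>\<^sub>N
              else \<infinity>))"
proof -
  interpret prob_space M by fact
  interpret C: compound_sums M X N \<Lambda>\<^sub>N
    using assms(2-8) by unfold_locales
  have Z: "(\<lambda>n \<omega>. (S (N n \<omega>) \<omega> /\<^sub>R real n, real (N n \<omega>) / real n)) = C.Z"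
    unfolding C.Z_def C.S_def S_def by (rule refl)
  have "satisfies_LDP M C.Z real (rate_SN \<Lambda>\<^sub>X \<Lambda>\<^sub>N)" "good_rate (rate_SN \<Lambda>\<^sub>X \<Lambda>\<^sub>N)"
    unfolding \<Lambda>\<^sub>X_def C.rate_SN_eq_dual_conjugate
    using gartner_ellis_LDP[OF C.Z_measurable C.gartner_ellis_Z C.L_0] by auto
  moreover have "rate_SN \<Lambda>\<^sub>X \<Lambda>\<^sub>N (x, y) =
      (if y > 0 then ereal y * dual_conjugate \<Lambda>\<^sub>X (x /\<^sub>R y) + real_conjugate \<Lambda>\<^sub>N y
       else if (x, y) = (0, 0) then - limit_at_minus_infinity \<Lambda>\<^sub>N else \<infinity>)" for x y
    unfolding \<Lambda>\<^sub>X_def using C.rate_SN_pos C.rate_SN_zero C.rate_SN_infinite by auto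
  ultimately show ?thesis unfolding Z by blast
qed

end
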